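(* Let $p$ be a prime and $m$ an integer with $m\ge 2$ if $p$ is odd and $m\ge 3$ if $p=2$. Let $G = C_{p^m}\rtimes_\alpha C_p$, where $\alpha(y)\equiv \beta p^{m-1}+1 \bmod p^m$ for some $\beta\in\{1,\dots,p-1\}$. 1) If $p$ is odd, then $$\mathrm{Spec}_R(G) = \{p^i\mid 1\le i\le m-1\}\cup\{2p^{m-1}-p^{m-2},\ p^m+p^{m-1}-p^{m-2}\}.$$ 2) If $p=2$, then $$\mathrm{Spec}_R(G) = \{2^i\mid 2\le i\le m-1\}\cup\{2^m-2^{m-2},\ 2^m+2^{m-2}\}.$$
   Context: For a group $G$ and $\varphi \in \mathrm{Aut}(G)$, elements $g_1,g_2\in G$ are $\varphi$-conjugate if $g_1 = g g_2 \varphi(g)^{-1}$ for some $g\in G$; the Reidemeister number $R(\varphi)$ is the number of equivalence classes of this relation, and $\mathrm{Spec}_R(G) = \{R(\varphi) \mid \varphi\in \mathrm{Aut}(G)\}$. $C_k$ denotes the cyclic group of order $k$; $\alpha: C_p\to\mathrm{Aut}(C_{p^m})$ is a homomorphism; $x,y$ are fixed generators of $C_{p^m}$ and $C_p$; $\alpha(y)$ is regarded as an integer modulo $p^m$ via $x^y = y^{-1}xy = x^{\alpha(y)}$ in $G$. (In the paper such a $G$ is called an $SMC(1,m,p)$.) *)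

theory Defs
  imports "HOL-Algebra.Bij" "HOL-Algebra.Generated_Groups" "HOL-Number_Theory.Cong"
begin

text \<open>The action convention is that \<open>\<alpha> k h\<close> is \<open>k h k\<^sup>-\<^sup>1\<close> inside the
  semidirect product; see \<open>semidirect_prod_conj\<close> below.\<close>

definition semidirect_prod ::
  "('a, 'c) monoid_scheme \<Rightarrow> ('b, 'd) monoid_scheme \<Rightarrow> ('b \<Rightarrow> 'a \<Rightarrow> 'a) \<Rightarrow> ('a \<times> 'b) monoid"
  where "semidirect_prod H K \<alpha> =
    \<lparr>carrier = carrier H \<times> carrier K,
     monoid.mult = \<lambda>(h, k) (h', k'). (h \<otimes>\<^bsub>H\<^esub> \<alpha> k h', k \<otimes>\<^bsub>K\<^esub> k'),
     one = (\<one>\<^bsub>H\<^esub>, \<one>\<^bsub>K\<^esub>)\<rparr>"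

definition twisted_conj_rel :: "('a, 'c) monoid_scheme \<Rightarrow> ('a \<Rightarrow> 'a) \<Rightarrow> ('a \<times> 'a) set"
  where "twisted_conj_rel G \<phi> =
    {(g1, g2). g1 \<in> carrier G \<and> g2 \<in> carrier G \<and>
       (\<exists>g \<in> carrier G. g1 = g \<otimes>\<^bsub>G\<^esub> g2 \<otimes>\<^bsub>G\<^esub> inv\<^bsub>G\<^esub> (\<phi> g))}"

text \<open>Being a natural number, this is meaningful only when there are finitely many classes
  (\<open>card\<close> of an infinite set is 0), in particular for every finite group.\<close>

definition reidemeister_number :: "('a, 'c) monoid_scheme \<Rightarrow> ('a \<Rightarrow> 'a) \<Rightarrow> nat"
  where "reidemeister_number G \<phi> = card (carrier G // twisted_conj_rel G \<phi>)"

definition reidemeister_spectrum :: "('a, 'c) monoid_scheme \<Rightarrow> nat set"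
  where "reidemeister_spectrum G = {reidemeister_number G \<phi> | \<phi>. \<phi> \<in> auto G}"

lemma equiv_twisted_conj_rel:
  fixes G (structure)
  assumes "group G" and "\<phi> \<in> auto G"
  shows "equiv (carrier G) (twisted_conj_rel G \<phi>)"
proof -
  interpret group G by fact
  have hom: "\<phi> \<in> hom G G" using assms(2) by (simp add: auto_def)
  have cl [simp]: "\<phi> g \<in> carrier G" if "g \<in> carrier G" for g
    using hom_in_carrier[OF hom that] .
  interpret \<phi>: group_hom G G \<phi> by unfold_locales (fact hom)
  show ?thesis
  proof (rule equivI)
    show "twisted_conj_rel G \<phi> \<subseteq> carrier G \<times> carrier G"
      by (auto simp: twisted_conj_rel_def)
    show "refl_on (carrier G) (twisted_conj_rel G \<phi>)"
      by (auto simp: twisted_conj_rel_def intro!: refl_onI bexI[of _ "\<one>"])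
    show "sym (twisted_conj_rel G \<phi>)"
    proof (rule symI)
      fix a b assume "(a, b) \<in> twisted_conj_rel G \<phi>"
      then obtain g where g: "g \<in> carrier G" "b \<in> carrier G" "a = g \<otimes> b \<otimes> inv (\<phi> g)"
        by (auto simp: twisted_conj_rel_def)
      have "inv g \<otimes> (g \<otimes> b) = b"
        using g by (simp flip: m_assoc)
      with g have "b = inv g \<otimes> a \<otimes> inv (\<phi> (inv g))"
        by (simp add: m_assoc)
      moreover have "inv g \<in> carrier G" "a \<in> carrier G" using g by auto
      ultimately show "(b, a) \<in> twisted_conj_rel G \<phi>"
        using g(2) unfolding twisted_conj_rel_def by blast
    qed
    show "trans (twisted_conj_rel G \<phi>)"
    proof (rule transI)
      fix a b c assume "(a, b) \<in> twisted_conj_rel G \<phi>" "(b, c) \<in> twisted_conj_rel G \<phi>"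
      then obtain g h where g: "g \<in> carrier G" "h \<in> carrier G" "c \<in> carrier G"
        "a = g \<otimes> b \<otimes> inv (\<phi> g)" "b = h \<otimes> c \<otimes> inv (\<phi> h)"
        by (auto simp: twisted_conj_rel_def)
      then have "a = (g \<otimes> h) \<otimes> c \<otimes> inv (\<phi> (g \<otimes> h))"
        by (simp add: m_assoc inv_mult_group)
      moreover have "g \<otimes> h \<in> carrier G" "a \<in> carrier G" using g by auto
      ultimately show "(a, c) \<in> twisted_conj_rel G \<phi>"
        using g(3) unfolding twisted_conj_rel_def by blast
    qed
  qed
qed

context
  fixes H :: "('a, 'c) monoid_scheme" and K :: "('b, 'd) monoid_scheme" and \<alpha>
  assumes H: "group H" and K: "group K" and \<alpha>: "\<alpha> \<in> hom K (AutoGroup H)"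
begin

interpretation H: group H by (fact H)
interpretation K: group K by (fact K)

lemma action_auto: "k \<in> carrier K \<Longrightarrow> \<alpha> k \<in> auto H"
  using hom_in_carrier[OF \<alpha>] by (simp add: AutoGroup_def)

lemma action_closed: "k \<in> carrier K \<Longrightarrow> h \<in> carrier H \<Longrightarrow> \<alpha> k h \<in> carrier H"
  using action_auto by (auto simp: auto_def hom_def)

lemma action_mult:
  "k \<in> carrier K \<Longrightarrow> h \<in> carrier H \<Longrightarrow> h' \<in> carrier H \<Longrightarrow>
    \<alpha> k (h \<otimes>\<^bsub>H\<^esub> h') = \<alpha> k h \<otimes>\<^bsub>H\<^esub> \<alpha> k h'"
  using action_auto by (auto simp: auto_def hom_def)

lemma action_comp:
  assumes "k \<in> carrier K" "k' \<in> carrier K" "h \<in> carrier H"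
  shows "\<alpha> (k \<otimes>\<^bsub>K\<^esub> k') h = \<alpha> k (\<alpha> k' h)"
  using hom_mult[OF \<alpha> assms(1,2)] action_auto assms
  by (simp add: AutoGroup_def BijGroup_def auto_def compose_def)

lemma action_one:
  assumes "h \<in> carrier H" shows "\<alpha> \<one>\<^bsub>K\<^esub> h = h"
proof -
  have "\<alpha> \<one>\<^bsub>K\<^esub> = \<one>\<^bsub>AutoGroup H\<^esub>"
    using hom_one[OF \<alpha> K H.AutoGroup] .
  then show ?thesis using assms by (simp add: AutoGroup_def BijGroup_def)
qed

lemma group_semidirect_prod: "group (semidirect_prod H K \<alpha>)"
proof (rule groupI)
  fix x assume "x \<in> carrier (semidirect_prod H K \<alpha>)"
  then obtain h k where x: "x = (h, k)" "h \<in> carrier H" "k \<in> carrier K"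
    by (auto simp: semidirect_prod_def)
  let ?y = "(\<alpha> (inv\<^bsub>K\<^esub> k) (inv\<^bsub>H\<^esub> h), inv\<^bsub>K\<^esub> k)"
  have "\<alpha> (inv\<^bsub>K\<^esub> k) \<one>\<^bsub>H\<^esub> = \<one>\<^bsub>H\<^esub>"
    using action_mult[of "inv\<^bsub>K\<^esub> k" "\<one>\<^bsub>H\<^esub>" "\<one>\<^bsub>H\<^esub>"] action_closed[of "inv\<^bsub>K\<^esub> k" "\<one>\<^bsub>H\<^esub>"] x
    by (metis H.l_one H.one_closed H.r_cancel_one K.inv_closed)
  then have "?y \<otimes>\<^bsub>semidirect_prod H K \<alpha>\<^esub> x = \<one>\<^bsub>semidirect_prod H K \<alpha>\<^esub>"
    using x by (simp add: semidirect_prod_def flip: action_mult)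
  then show "\<exists>y\<in>carrier (semidirect_prod H K \<alpha>).
      y \<otimes>\<^bsub>semidirect_prod H K \<alpha>\<^esub> x = \<one>\<^bsub>semidirect_prod H K \<alpha>\<^esub>"
    using x by (intro bexI[of _ ?y]) (auto simp: semidirect_prod_def action_closed)
qed (auto simp: semidirect_prod_def action_closed action_mult action_comp action_one
    H.m_assoc K.m_assoc)

lemma semidirect_prod_conj:
  assumes "h \<in> carrier H" "k \<in> carrier K"
  shows "(\<one>\<^bsub>H\<^esub>, k) \<otimes>\<^bsub>semidirect_prod H K \<alpha>\<^esub> (h, \<one>\<^bsub>K\<^esub>)
      \<otimes>\<^bsub>semidirect_prod H K \<alpha>\<^esub> inv\<^bsub>semidirect_prod H K \<alpha>\<^esub> (\<one>\<^bsub>H\<^esub>, k) = (\<alpha> k h, \<one>\<^bsub>K\<^esub>)"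
proof -
  interpret G: group "semidirect_prod H K \<alpha>" by (rule group_semidirect_prod)
  have "(\<one>\<^bsub>H\<^esub>, k) \<otimes>\<^bsub>semidirect_prod H K \<alpha>\<^esub> (h, \<one>\<^bsub>K\<^esub>)
      = (\<alpha> k h, \<one>\<^bsub>K\<^esub>) \<otimes>\<^bsub>semidirect_prod H K \<alpha>\<^esub> (\<one>\<^bsub>H\<^esub>, k)"
    using assms by (simp add: semidirect_prod_def action_closed action_one)
  moreover have "(\<one>\<^bsub>H\<^esub>, k) \<in> carrier (semidirect_prod H K \<alpha>)"
    "(h, \<one>\<^bsub>K\<^esub>) \<in> carrier (semidirect_prod H K \<alpha>)"
    "(\<alpha> k h, \<one>\<^bsub>K\<^esub>) \<in> carrier (semidirect_prod H K \<alpha>)"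
    using assms by (auto simp: semidirect_prod_def action_closed)
  ultimately show ?thesis by (simp add: G.m_assoc)
qed

end

end

theory Submission
  imports Defs "HOL-Algebra.Multiplicative_Group"
begin

text \<open>
  Write \<open>u\<close>, \<open>v\<close> for the generators, \<open>q = p ^ (m - 1)\<close>, and \<open>T i = i (i - 1) / 2\<close>. Since
  \<open>[u, v]\<close> is a power of the central element \<open>u ^ q\<close> of order \<open>p\<close>, the group has class two, and
  \<open>u\<^sup>i v\<^sup>j u\<^sup>k v\<^sup>l = u ^ (i + k + c q j k) v ^ (j + l)\<close> with a unit \<open>c = - \<beta>\<close> modulo \<open>p\<close>. The
  whole proof takes place in these integer coordinates.

  Automorphisms: \<open>\<phi>\<close> is determined by \<open>\<phi> u = u\<^sup>a v\<^sup>b\<close> and \<open>\<phi> v\<close>. As \<open>\<phi> v\<close> has order \<open>p\<close> and the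
  commutator relation survives, \<open>\<phi> v = u ^ (d q) v\<close> and \<open>a\<close> is a unit modulo \<open>p\<close>
  (\<open>automorphism_coordinates\<close>). Conversely every unit \<open>a\<close> and every \<open>b\<close> occur, with \<open>d = 0\<close>
  (\<open>ex_automorphism\<close>).

  Counting: the twisted classes are the orbits of \<open>g \<cdot> h = g h \<phi>(g)\<^sup>-\<^sup>1\<close>, so Burnside's lemma
  (\<open>burnside_twisted_conjugacy\<close>) gives \<open>R(\<phi>) |G|\<close> as the number of pairs with \<open>g h = h \<phi>(g)\<close>.
  For fixed \<open>g = u\<^sup>i v\<^sup>j\<close> this is a congruence in the coordinates of \<open>h\<close>. For central \<open>g\<close> it does
  not depend on \<open>h\<close>, so the number of solutions is 0 or \<open>|G|\<close>; otherwise it is 0 or \<open>|G| / p\<close>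
  (\<open>card_twisted_stabilizer\<close>). Summing over \<open>i\<close> and \<open>j\<close> leaves solution counts of linear
  congruences modulo \<open>q\<close>, that is, the numbers \<open>gcd (a - 1) q\<close> and \<open>gcd (p (a - 1)) q\<close>, plus the
  number of fixed points in the centre (\<open>reidemeister_number_gcd\<close>).

  For odd \<open>p\<close>, \<open>\<phi>\<close> acts on the centre as the \<open>a\<close>-th power and the third number is again
  \<open>gcd (a - 1) q\<close>. For \<open>p = 2\<close> the squaring \<open>(u\<^sup>a v\<^sup>b)\<^sup>2\<close> picks up a commutator, which shifts
  \<open>a - 1\<close> by an odd multiple of \<open>2 ^ (m - 2)\<close> when \<open>b\<close> is odd; this is the source of the
  exceptional value \<open>2 ^ m - 2 ^ (m - 2)\<close>. Everything now depends only on \<open>b\<close> modulo \<open>p\<close> being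
  zero or not and on \<open>e = min (m - 1) (v\<^sub>p(a - 1))\<close>, and running through all these cases gives the
  spectrum.
\<close>

section \<open>Burnside counting for twisted conjugacy\<close>

text \<open>
  Twisted conjugacy classes are the orbits of the action \<open>g \<cdot> h = g h \<phi>(g)\<^sup>-\<^sup>1\<close>, and \<open>g h = h \<phi>(g)\<close>
  says that \<open>g\<close> fixes \<open>h\<close>. Along one orbit the stabilizers have cardinalities summing to the group
  order, because the elements that move a base point to \<open>h\<close> form a coset of the stabilizer of \<open>h\<close>.
\<close>
lemma burnside_twisted_conjugacy:
  fixes G (structure)
  assumes "group G" and fin: "finite (carrier G)" and \<phi>: "\<phi> \<in> auto G"
  shows "reidemeister_number G \<phi> * Coset.order G =
    card {(g, h). g \<in> carrier G \<and> h \<in> carrier G \<and> g \<otimes> h = h \<otimes> \<phi> g}"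
proof -
  interpret group G by fact
  have hom: "\<phi> \<in> hom G G" using \<phi> by (simp add: auto_def)
  have cl [simp]: "\<phi> g \<in> carrier G" if "g \<in> carrier G" for g
    using hom_in_carrier[OF hom that] .
  interpret \<phi>: group_hom G G \<phi> by unfold_locales (fact hom)
  let ?r = "twisted_conj_rel G \<phi>"
  define stab where "stab h = {g \<in> carrier G. g \<otimes> h = h \<otimes> \<phi> g}" for h
  have eq: "equiv (carrier G) ?r" by (rule equiv_twisted_conj_rel) fact+
  have class_sum: "(\<Sum>h\<in>C. card (stab h)) = Coset.order G" if C: "C \<in> carrier G // ?r" for C
  proof -
    obtain h0 where h0: "h0 \<in> carrier G" and C_eq: "C = ?r `` {h0}"
      using C by (rule quotientE)
    have C_eq': "C = {h \<in> carrier G. (h, h0) \<in> ?r}"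
    proof -
      have "sym ?r" "?r \<subseteq> carrier G \<times> carrier G" using eq by (auto elim: equivE)
      then show ?thesis unfolding C_eq by (blast dest: symD)
    qed
    have fC: "finite C" using fin by (auto simp: C_eq')
    \<comment> \<open>\<open>T h\<close> collects the elements that move the base point \<open>h0\<close> to \<open>h\<close>.\<close>
    define T where "T h = {g \<in> carrier G. g \<otimes> h0 \<otimes> inv (\<phi> g) = h}" for h
    have "card (stab h) = card (T h)" if "h \<in> C" for h
    proof -
      from that h0 obtain t where t: "t \<in> carrier G" "h = t \<otimes> h0 \<otimes> inv (\<phi> t)"
        and h: "h \<in> carrier G"
        by (auto simp: C_eq' twisted_conj_rel_def)
      have transl: "s \<otimes> t \<in> T h \<longleftrightarrow> s \<in> stab h" if s: "s \<in> carrier G" for s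
      proof -
        have "s \<otimes> t \<otimes> h0 \<otimes> inv (\<phi> (s \<otimes> t)) = s \<otimes> h \<otimes> inv (\<phi> s)"
          using s t h0 by (simp add: inv_mult_group m_assoc)
        moreover have "s \<otimes> h \<otimes> inv (\<phi> s) = h \<longleftrightarrow> s \<otimes> h = h \<otimes> \<phi> s"
          using s h inv_solve_right'[of h "s \<otimes> h" "\<phi> s"] by auto
        ultimately show ?thesis using s t by (simp add: T_def stab_def)
      qed
      have "bij_betw (\<lambda>s. s \<otimes> t) (stab h) (T h)"
      proof (rule bij_betwI[where g = "\<lambda>s. s \<otimes> inv t"])
        show "(\<lambda>s. s \<otimes> t) \<in> stab h \<rightarrow> T h" using transl by (auto simp: stab_def)
        show "(\<lambda>s. s \<otimes> inv t) \<in> T h \<rightarrow> stab h"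
        proof
          fix s assume "s \<in> T h"
          then show "s \<otimes> inv t \<in> stab h"
            using transl[of "s \<otimes> inv t"] t by (simp add: T_def m_assoc)
        qed
      qed (use t in \<open>auto simp: stab_def T_def m_assoc\<close>)
      then show ?thesis by (rule bij_betw_same_card)
    qed
    then have "(\<Sum>h\<in>C. card (stab h)) = (\<Sum>h\<in>C. card (T h))" by simp
    also have "\<dots> = card (\<Union>h\<in>C. T h)"
      using fC fin by (intro card_UN_disjoint[symmetric]) (auto simp: T_def)
    also have "(\<Union>h\<in>C. T h) = carrier G"
      using h0 by (auto simp: T_def C_eq' twisted_conj_rel_def)
    finally show ?thesis by (simp add: Coset.order_def)
  qed
  have "{(g, h). g \<in> carrier G \<and> h \<in> carrier G \<and> g \<otimes> h = h \<otimes> \<phi> g}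
      = prod.swap ` (SIGMA h : carrier G. stab h)"
    by (auto simp: stab_def image_iff)
  then have "card {(g, h). g \<in> carrier G \<and> h \<in> carrier G \<and> g \<otimes> h = h \<otimes> \<phi> g}
      = card (SIGMA h : carrier G. stab h)"
    by (simp add: card_image)
  also have "\<dots> = (\<Sum>h\<in>carrier G. card (stab h))"
    using fin by (intro card_SigmaI) (auto simp: stab_def)
  also have "\<dots> = (\<Sum>h\<in>\<Union>(carrier G // ?r). card (stab h))"
    by (simp add: Union_quotient[OF eq])
  also have "\<dots> = (\<Sum>C\<in>carrier G // ?r. \<Sum>h\<in>C. card (stab h))"
  proof (rule sum.Union_disjoint[unfolded comp_def])
    show "\<forall>C\<in>carrier G // ?r. finite C"
      using finite_equiv_class[OF fin] equivE[OF eq] by metis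
    show "\<forall>C\<in>carrier G // ?r. \<forall>D\<in>carrier G // ?r. C \<noteq> D \<longrightarrow> C \<inter> D = {}"
      using quotient_disj[OF eq] by blast
  qed
  also have "\<dots> = reidemeister_number G \<phi> * Coset.order G"
    using class_sum by (simp add: reidemeister_number_def)
  finally show ?thesis by simp
qed

section \<open>Counting solutions of linear congruences\<close>

lemma card_residue_class:
  fixes r :: int and n d :: nat
  assumes "d > 0"
  shows "card {k \<in> {0..<int (n * d)}. int d dvd k - r} = n"
proof -
  have "{k \<in> {0..<int (n * d)}. int d dvd k - r} = (\<lambda>t. int d * int t + r mod int d) ` {..<n}"
    (is "?L = ?f ` _")
  proof (intro equalityI subsetI)
    fix k assume k: "k \<in> ?L"
    then have "k mod int d = r mod int d" by (simp add: mod_eq_dvd_iff)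
    then have *: "k = int d * (k div int d) + r mod int d" by (metis mult_div_mod_eq)
    have "0 \<le> k div int d" using k assms by (simp add: pos_imp_zdiv_nonneg_iff)
    moreover have "k div int d < int n"
    proof (rule ccontr)
      assume "\<not> ?thesis"
      then have "int d * int n \<le> int d * (k div int d)" by (intro mult_left_mono) auto
      also have "\<dots> \<le> k" using * assms by (metis le_add_same_cancel1 of_nat_0_less_iff pos_mod_sign
        mult_div_mod_eq)
      finally show False using k by (simp add: mult.commute)
    qed
    ultimately show "k \<in> ?f ` {..<n}"
      using * by (intro image_eqI[of _ _ "nat (k div int d)"]) auto
  next
    fix k assume "k \<in> ?f ` {..<n}"
    then obtain t where t: "t < n" "k = int d * int t + r mod int d" by auto
    have "k < int d * (int t + 1)" "0 \<le> k" using t assms by (simp_all add: algebra_simps)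
    moreover have "int d * (int t + 1) \<le> int d * int n" using t by (intro mult_left_mono) auto
    moreover have "int d dvd k - r" using t by (simp flip: mod_eq_dvd_iff)
    ultimately show "k \<in> ?L" by (simp add: mult.commute)
  qed
  moreover have "inj_on ?f {..<n}" using assms by (auto simp: inj_on_def)
  ultimately show ?thesis by (simp add: card_image)
qed

lemma card_linear_congruence:
  fixes A :: int and k n :: nat
  assumes "n > 0"
  shows "int (card {i \<in> {0..<int (k * n)}. int n dvd A * i}) = int k * gcd A (int n)"
proof -
  define g where "g = gcd A (int n)"
  have g: "g > 0" using assms by (simp add: g_def)
  obtain A' n' where A': "A = A' * g" "int n = n' * g" "coprime A' n'"
    using gcd_coprime_exists[of A "int n"] assms unfolding g_def by auto
  have n': "n' > 0" using A'(2) g assms by (metis of_nat_0_less_iff zero_less_mult_pos2)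
  have "int n dvd A * i \<longleftrightarrow> n' dvd i" for i
  proof -
    have "int n dvd A * i \<longleftrightarrow> n' * g dvd (A' * i) * g" using A' by (simp add: ac_simps)
    also have "\<dots> \<longleftrightarrow> n' dvd i" using g A'(3)
      by (simp add: coprime_dvd_mult_right_iff coprime_commute)
    finally show ?thesis .
  qed
  moreover have "k * n = (k * nat g) * nat n'"
    using A'(2) g n' by (metis mult.assoc mult.commute nat_int nat_mult_distrib order_less_imp_le)
  ultimately have "{i \<in> {0..<int (k * n)}. int n dvd A * i}
      = {i \<in> {0..<int ((k * nat g) * nat n')}. int (nat n') dvd i - 0}"
    using n' by (simp only:) simp
  then have "card {i \<in> {0..<int (k * n)}. int n dvd A * i} = k * nat g"
    using card_residue_class[of "nat n'" "k * nat g" 0] n' by simp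
  then show ?thesis using g by (simp add: g_def)
qed

lemma card_affine_congruence:
  fixes s w :: int and p n :: nat
  assumes "prime p" and "\<not> int p dvd s"
  shows "card {k \<in> {0..<int (n * p)}. int p dvd w + s * k} = n"
proof -
  have "coprime s (int p)"
    using assms by (metis coprime_commute prime_imp_coprime prime_nat_int_transfer)
  then obtain t where t: "[s * t = 1] (mod int p)" using cong_solve_coprime_int by blast
  have "int p dvd w + s * k \<longleftrightarrow> int p dvd k - (- w * t)" for k
  proof -
    have "int p dvd s * (k + w * t) - (w + s * k)"
    proof -
      have "s * (k + w * t) - (w + s * k) = w * (s * t - 1)" by (simp add: algebra_simps)
      then show ?thesis using t by (simp add: cong_iff_dvd_diff)
    qed
    then have "int p dvd w + s * k \<longleftrightarrow> int p dvd s * (k + w * t)"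
      by (metis diff_add_cancel dvd_add_right_iff)
    also have "\<dots> \<longleftrightarrow> int p dvd k + w * t"
      using \<open>coprime s (int p)\<close> by (simp add: coprime_dvd_mult_right_iff coprime_commute)
    finally show ?thesis by simp
  qed
  then show ?thesis using card_residue_class[of p n "- w * t"] assms by (simp add: prime_gt_0_nat)
qed

text \<open>
  A linear form that does not vanish modulo \<open>p\<close> takes every residue equally often, so one of the
  \<open>p\<close> parts of the rectangle of size \<open>(n p) p\<close> solves the congruence.
\<close>
lemma card_affine_congruence_pairs:
  fixes s t w :: int and p n :: nat
  assumes "prime p" and "\<not> (int p dvd s \<and> int p dvd t)"
  shows "card {(k, l). k \<in> {0..<int (n * p)} \<and> l \<in> {0..<int p} \<and> int p dvd w + s * k + t * l} = n * p"
    (is "card ?S = _")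
proof (cases "int p dvd t")
  case False
  have "?S = (SIGMA k : {0..<int (n * p)}. {l \<in> {0..<int p}. int p dvd w + s * k + t * l})" by auto
  then have "card ?S = (\<Sum>k\<in>{0..<int (n * p)}. 1)"
    using card_affine_congruence[OF assms(1) False, of 1] by (subst \<open>?S = _\<close>, subst card_SigmaI) (simp_all del: atLeastLessThan_iff)
  then show ?thesis by (simp add: nat_mult_distrib)
next
  case True
  with assms have s: "\<not> int p dvd s" by blast
  have "?S = prod.swap ` (SIGMA l : {0..<int p}. {k \<in> {0..<int (n * p)}. int p dvd (w + t * l) + s * k})"
    by (auto simp: image_iff algebra_simps)
  then have "card ?S = card (SIGMA l : {0..<int p}. {k \<in> {0..<int (n * p)}. int p dvd (w + t * l) + s * k})"
    by (simp add: card_image)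
  also have "\<dots> = (\<Sum>l\<in>{0..<int p}. n)"
    using card_affine_congruence[OF assms(1) s, of n]
    by (subst card_SigmaI) (simp_all del: atLeastLessThan_iff)
  finally show ?thesis by simp
qed

lemma gcd_prime_power_eq:
  fixes p e n :: nat and A :: int
  assumes "prime p" "e \<le> n" "int p ^ e dvd A" "e = n \<or> \<not> int p ^ Suc e dvd A"
  shows "gcd A (int p ^ n) = int p ^ e"
proof -
  have pi: "prime (int p)" using assms(1) by simp
  obtain f where f: "f \<le> n" "gcd A (int p ^ n) = int p ^ f"
    using divides_primepow[OF pi gcd_dvd2[of A "int p ^ n"]] by auto
  have "int p ^ e dvd int p ^ f"
    using assms by (simp flip: f(2) add: le_imp_power_dvd)
  then have "p ^ e dvd p ^ f" by (metis of_nat_dvd_iff of_nat_power)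
  then have "e \<le> f" using prime_gt_1_nat[OF assms(1)] by (rule power_dvd_imp_le)
  moreover have "f \<le> e"
  proof (rule ccontr)
    assume "\<not> f \<le> e"
    then have "int p ^ Suc e dvd int p ^ f" by (intro le_imp_power_dvd) simp
    also have "\<dots> dvd A" by (simp flip: f(2))
    finally show False using assms(4) \<open>\<not> f \<le> e\<close> f(1) by auto
  qed
  ultimately show ?thesis using f by simp
qed

text \<open>
  The exponent \<open>e\<close> is \<open>min n (v\<^sub>p(A))\<close>, a form that also covers \<open>A = 0\<close>. It matches the hypotheses
  of \<open>gcd_prime_power_eq\<close>.
\<close>
lemma obtain_capped_multiplicity:
  fixes p n :: nat and A :: int
  assumes "prime p"
  obtains e where "e \<le> n" "int p ^ e dvd A" "e = n \<or> \<not> int p ^ Suc e dvd A"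
proof -
  define e where "e = (GREATEST e. e \<le> n \<and> int p ^ e dvd A)"
  have e: "e \<le> n \<and> int p ^ e dvd A"
    unfolding e_def by (rule GreatestI_nat[of _ 0 n]) auto
  moreover have "e = n \<or> \<not> int p ^ Suc e dvd A"
  proof (rule ccontr)
    assume "\<not> ?thesis"
    with e have "Suc e \<le> n \<and> int p ^ Suc e dvd A" by auto
    then have "Suc e \<le> e" unfolding e_def by (rule Greatest_le_nat[where b = n]) auto
    then show False by simp
  qed
  ultimately show ?thesis using that by blast
qed

section \<open>Coordinates on the group\<close>

text \<open>
  The binomial coefficient \<open>i choose 2\<close>, extended to negative \<open>i\<close> by the same polynomial. It counts
  the commutators that appear when \<open>(u\<^sup>a v\<^sup>b)\<^sup>i\<close> is brought into normal form.
\<close>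
definition triangle :: "int \<Rightarrow> int"
  where "triangle i = i * (i - 1) div 2"

lemma two_triangle: "2 * triangle i = i * (i - 1)"
  by (simp add: triangle_def)

lemma triangle_add: "triangle (i + k) = triangle i + triangle k + i * k"
proof -
  have "2 * triangle (i + k) = 2 * (triangle i + triangle k + i * k)"
    by (simp add: distrib_left two_triangle) (simp add: algebra_simps)
  then show ?thesis by simp
qed

lemma triangle_simps [simp]: "triangle 0 = 0" "triangle 1 = 0"
  by (simp_all add: triangle_def)

lemma dvd_triangle_odd:
  assumes "odd d" and "d dvd i"
  shows "d dvd triangle i"
proof -
  have "d dvd 2 * triangle i" using assms(2) by (simp add: two_triangle)
  moreover have "coprime d 2" using assms(1) by simp
  ultimately show ?thesis by (simp add: coprime_dvd_mult_right_iff)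
qed

text \<open>
  The element \<open>E i j\<close> stands for \<open>u\<^sup>i v\<^sup>j\<close>. Exponents are arbitrary integers, determined only modulo
  \<open>p ^ m\<close> and \<open>p\<close>, so that products and powers are given by polynomials without any reduction. The
  constant \<open>c\<close> records the commutator \<open>[v, u] = u ^ (c q)\<close>.
\<close>
locale modular_group_coordinates = group G for G (structure) +
  fixes E :: "int \<Rightarrow> int \<Rightarrow> 'a" and p m :: nat and c :: int
  assumes prime_p: "prime p"
    and m_ge: "m \<ge> 2" "p = 2 \<Longrightarrow> m \<ge> 3"
    and c_unit: "\<not> int p dvd c"
    and carrier_eq: "carrier G = range (case_prod E)"
    and E_eq_iff_power: "E i j = E k l \<longleftrightarrow> int p ^ m dvd i - k \<and> int p dvd j - l"
    and E_mult: "E i j \<otimes> E k l = E (i + k + c * int p ^ (m - 1) * j * k) (j + l)"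
begin

abbreviation \<pi> :: int where "\<pi> \<equiv> int p"
abbreviation q :: int where "q \<equiv> int p ^ (m - 1)"

lemma prime_pi: "prime \<pi>"
  using prime_p by simp

lemma pi_pos: "\<pi> > 0" and q_pos: "q > 0"
  using prime_p by (simp_all add: prime_gt_0_nat)

lemma power_m: "int p ^ m = \<pi> * q" "p ^ m = p * p ^ (m - 1)"
  using m_ge(1) by (simp_all flip: power_Suc)

lemma E_eq_iff: "E i j = E k l \<longleftrightarrow> \<pi> * q dvd i - k \<and> \<pi> dvd j - l"
  by (simp add: E_eq_iff_power power_m)

lemma pi_dvd_q: "\<pi> dvd q"
  using m_ge(1) by simp

lemma odd_pi: "p \<noteq> 2 \<Longrightarrow> odd \<pi>"
  using prime_p prime_odd_nat[of p] prime_ge_2_nat[of p] by auto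

lemma four_dvd_q: "p = 2 \<Longrightarrow> 4 dvd q"
proof -
  assume "p = 2"
  with m_ge have "(2::int) ^ 2 dvd 2 ^ (m - 1)" by (intro le_imp_power_dvd) auto
  then show ?thesis using \<open>p = 2\<close> by simp
qed

text \<open>
  The form in which equalities arise below: the first coordinates differ by a multiple of \<open>q\<close>, and
  only the cofactor has to be examined modulo \<open>p\<close>.
\<close>
lemma E_eqI:
  assumes "i - k = q * r" "\<pi> dvd r" "\<pi> dvd j - l"
  shows "E i j = E k l"
  using assms by (simp add: E_eq_iff mult.commute[of \<pi>])

lemma E_closed [simp, intro]: "E i j \<in> carrier G"
  by (auto simp: carrier_eq)

lemma E_cases:
  assumes "g \<in> carrier G"
  obtains i j where "g = E i j" "0 \<le> i" "i < \<pi> * q" "0 \<le> j" "j < \<pi>"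
proof -
  obtain i j where "g = E i j" using assms by (auto simp: carrier_eq)
  also have "\<dots> = E (i mod (\<pi> * q)) (j mod \<pi>)"
    by (simp add: E_eq_iff dvd_minus_mod)
  finally show ?thesis using that pi_pos q_pos by simp
qed

lemma one_eq: "\<one> = E 0 0"
proof -
  have "E 0 0 \<otimes> E 0 0 = E 0 0" by (simp add: E_mult)
  then show ?thesis by (metis E_closed l_cancel_one)
qed

text \<open>
  For odd \<open>p\<close> the factor \<open>p\<close> of \<open>i\<close> survives the division by two. For \<open>p = 2\<close> the division costs one
  factor, and \<open>m \<ge> 3\<close> provides it: then \<open>4\<close> divides \<open>q\<close>.
\<close>
lemma pi_dvd_triangle:
  assumes "q dvd i"
  shows "\<pi> dvd triangle i"
proof (cases "p = 2")
  case True
  then have "4 dvd i" using assms four_dvd_q dvd_trans by blast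
  then obtain r where "i = 4 * r" by blast
  then have "2 * triangle i = 2 * (2 * (r * (4 * r - 1)))" by (simp add: two_triangle)
  then show ?thesis using True by simp
next
  case False
  then show ?thesis using odd_pi assms pi_dvd_q dvd_trans dvd_triangle_odd by blast
qed

lemma E_pow: "E i j [^] n = E (int n * i + c * q * i * j * triangle (int n)) (int n * j)" for n :: nat
proof (induction n)
  case 0
  then show ?case by (simp add: one_eq)
next
  case (Suc n)
  have "triangle (int (Suc n)) = triangle (int n) + int n"
    using triangle_add[of "int n" 1] by (simp add: add.commute)
  with Suc show ?case by (simp add: E_mult) (simp add: algebra_simps)
qed

lemma bij_betw_E: "bij_betw (case_prod E) ({0..<\<pi> * q} \<times> {0..<\<pi>}) (carrier G)"
proof (rule bij_betwI')
  fix s t assume "s \<in> {0..<\<pi> * q} \<times> {0..<\<pi>}" "t \<in> {0..<\<pi> * q} \<times> {0..<\<pi>}"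
  then show "case_prod E s = case_prod E t \<longleftrightarrow> s = t"
    by (auto simp: E_eq_iff simp flip: mod_eq_dvd_iff)
next
  fix g assume "g \<in> carrier G"
  then show "\<exists>s\<in>{0..<\<pi> * q} \<times> {0..<\<pi>}. g = case_prod E s"
    by (elim E_cases) force
qed auto

lemma finite_carrier: "finite (carrier G)"
  using bij_betw_finite[OF bij_betw_E] by simp

lemma order_eq: "Coset.order G = p * p ^ m"
  using bij_betw_same_card[OF bij_betw_E]
  by (simp add: Coset.order_def card_cartesian_product nat_mult_distrib nat_power_eq power_m ac_simps)

section \<open>The automorphisms\<close>

text \<open>
  Put \<open>\<phi> u = E a b\<close> and \<open>\<phi> v = E d' e\<close>. From \<open>(\<phi> v) ^ p = \<one>\<close> it follows that \<open>q\<close> divides \<open>d'\<close>. Moreover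
  \<open>\<phi> (u ^ q) = u ^ (a q)\<close>, so injectivity makes \<open>a\<close> a unit, and applying \<open>\<phi>\<close> to
  \<open>v u = u v u ^ (c q)\<close> forces \<open>a e \<equiv> a\<close>, hence \<open>e \<equiv> 1\<close>, modulo \<open>p\<close>.
  The restriction to nonnegative \<open>i\<close>, \<open>j\<close> lets \<open>E i j\<close> be written with natural powers; such
  representatives suffice for counting.
\<close>
lemma automorphism_coordinates:
  assumes \<phi>: "\<phi> \<in> auto G"
  obtains a b d where "\<not> \<pi> dvd a"
    "\<And>i j. 0 \<le> i \<Longrightarrow> 0 \<le> j \<Longrightarrow>
      \<phi> (E i j) = E (a * i + c * q * a * b * triangle i + d * q * j) (b * i + j)"
proof -
  have hom: "\<phi> \<in> hom G G" and inj: "inj_on \<phi> (carrier G)"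
    using \<phi> by (auto simp: auto_def Bij_def bij_betw_def)
  interpret \<phi>: group_hom G G \<phi> by unfold_locales (fact hom)
  obtain a b where u: "\<phi> (E 1 0) = E a b" by (meson E_cases E_closed \<phi>.hom_closed)
  obtain d' e where v: "\<phi> (E 0 1) = E d' e" by (meson E_cases E_closed \<phi>.hom_closed)
  have "q dvd d'"
  proof -
    have "E 0 1 [^] p = \<one>" by (simp add: E_pow one_eq E_eq_iff)
    then have "\<phi> (E 0 1 [^] p) = \<one>" by simp
    then have "E d' e [^] p = \<one>" by (simp add: \<phi>.hom_nat_pow v)
    then have *: "\<pi> * q dvd \<pi> * d' + c * q * d' * e * triangle \<pi>"
      by (simp add: E_pow one_eq E_eq_iff)
    show ?thesis
    proof (cases "p = 2")
      case True
      then obtain r where r: "q = 2 * (2 * r)" using four_dvd_q by (auto elim!: dvdE)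
      have "triangle \<pi> = 1" using True by (simp add: triangle_def)
      then have "\<pi> * d' + c * q * d' * e * triangle \<pi> = 2 * (d' * (1 + 2 * (c * e * r)))"
        unfolding r using True by (simp add: algebra_simps)
      then have "2 * q dvd 2 * (d' * (1 + 2 * (c * e * r)))" using * True by simp
      then have "q dvd d' * (1 + 2 * (c * e * r))" by simp
      moreover have "coprime q (1 + 2 * (c * e * r))" using True by simp
      ultimately show ?thesis by (simp add: coprime_dvd_mult_left_iff)
    next
      case False
      then have "\<pi> dvd triangle \<pi>" by (intro dvd_triangle_odd odd_pi) simp_all
      then have "\<pi> * q dvd c * q * d' * e * triangle \<pi>" by (auto elim!: dvdE)
      with * have "\<pi> * q dvd \<pi> * d'" by (simp add: dvd_add_left_iff)
      then show ?thesis using pi_pos by simp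
    qed
  qed
  then obtain d where d: "d' = q * d" by blast
  have z: "\<phi> (E q 0) = E (a * q) 0"
  proof -
    have "E q 0 = E 1 0 [^] (p ^ (m - 1))" by (simp add: E_pow)
    then have "\<phi> (E q 0) = E a b [^] (p ^ (m - 1))" by (simp add: \<phi>.hom_nat_pow u)
    also have "\<dots> = E (q * a + c * q * a * b * triangle q) (q * b)" by (simp add: E_pow)
    also have "\<dots> = E (a * q) 0"
      using pi_dvd_triangle[of q] pi_dvd_q
      by (intro E_eqI[of _ _ "c * a * b * triangle q"]) (simp_all add: algebra_simps)
    finally show ?thesis .
  qed
  have a: "\<not> \<pi> dvd a"
  proof
    assume "\<pi> dvd a"
    then have "\<phi> (E q 0) = \<one>" unfolding z one_eq by (simp add: E_eq_iff)
    then have "\<phi> (E q 0) = \<phi> \<one>" by simp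
    then have "E q 0 = \<one>" using inj by (simp add: inj_on_def)
    then have "\<pi> * q dvd 1 * q" by (simp add: one_eq E_eq_iff)
    then have "\<pi> dvd 1" using q_pos pi_pos by (simp only: dvd_mult_cancel_right) simp
    then show False using prime_pi not_prime_unit by blast
  qed
  have e: "\<pi> dvd e - 1"
  proof -
    have zc: "\<phi> (E (c * q) 0) = E (a * c * q) 0"
    proof -
      \<comment> \<open>A nonnegative representative of \<open>c\<close>, so that \<open>u ^ (c q)\<close> is a natural power of \<open>u ^ q\<close>.\<close>
      define n where "n = nat (c mod \<pi>)"
      have n: "int n = c mod \<pi>" using pi_pos by (simp add: n_def)
      have nc: "\<pi> dvd c - int n" by (simp add: n dvd_minus_mod)
      have "E (c * q) 0 = E (int n * q) 0"
        using nc by (intro E_eqI[of _ _ "c - int n"]) (simp_all add: algebra_simps)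
      also have "\<dots> = E q 0 [^] n" by (simp add: E_pow)
      finally have "\<phi> (E (c * q) 0) = \<phi> (E q 0) [^] n" by (simp only: \<phi>.hom_nat_pow E_closed)
      also have "\<dots> = E (int n * (a * q)) 0" unfolding z by (simp add: E_pow)
      also have "\<dots> = E (a * c * q) 0"
        using nc by (intro E_eqI[of _ _ "- (a * (c - int n))"]) (simp add: algebra_simps, simp_all)
      finally show ?thesis .
    qed
    have "E 0 1 \<otimes> E 1 0 = E 1 0 \<otimes> E 0 1 \<otimes> E (c * q) 0"
      using pi_dvd_q by (simp add: E_mult E_eq_iff)
    then have "\<phi> (E 0 1 \<otimes> E 1 0) = \<phi> (E 1 0 \<otimes> E 0 1 \<otimes> E (c * q) 0)" by simp
    then have "E d' e \<otimes> E a b = E a b \<otimes> E d' e \<otimes> E (a * c * q) 0"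
      by (simp only: \<phi>.hom_mult m_closed E_closed u v zc)
    then have "\<pi> * q dvd (d' + a + c * q * e * a) - (a + d' + c * q * b * d' + a * c * q
        + c * q * (b + e) * (a * c * q))"
      by (simp add: E_mult E_eq_iff)
    also have "(d' + a + c * q * e * a) - (a + d' + c * q * b * d' + a * c * q
        + c * q * (b + e) * (a * c * q))
      = (c * (a * (e - 1) - q * (b * d + (b + e) * (a * c)))) * q"
      by (simp add: d algebra_simps)
    finally have "\<pi> dvd c * (a * (e - 1) - q * (b * d + (b + e) * (a * c)))"
      using q_pos pi_pos by (simp only: dvd_mult_cancel_right) simp
    then have "\<pi> dvd a * (e - 1) - q * (b * d + (b + e) * (a * c))"
      using c_unit prime_dvd_mult_iff[OF prime_pi] by blast
    then have "\<pi> dvd a * (e - 1)"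
      using pi_dvd_q by (metis dvd_diff_left_iff dvd_mult2 dvd_diffD dvd_add_left_iff diff_add_cancel)
    then show ?thesis using a prime_dvd_mult_iff[OF prime_pi] by blast
  qed
  have "\<phi> (E i j) = E (a * i + c * q * a * b * triangle i + d * q * j) (b * i + j)"
    if "0 \<le> i" "0 \<le> j" for i j
  proof -
    have "E i j = E 1 0 [^] nat i \<otimes> E 0 1 [^] nat j" using that by (simp add: E_pow E_mult)
    then have "\<phi> (E i j) = E a b [^] nat i \<otimes> E d' e [^] nat j"
      by (simp add: \<phi>.hom_nat_pow u v)
    also have "\<dots> = E (a * i + c * q * a * b * triangle i + d * q * j) (b * i + j)"
    proof -
      \<comment> \<open>The remaining terms all contain \<open>q\<close> twice and therefore vanish.\<close>
      define w where "w = c * d * e * triangle j + c * (b * i) * (j * d + c * q * d * e * triangle j)"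
      have j: "(i * b + j * e) - (b * i + j) = (e - 1) * j" by (simp add: algebra_simps)
      have "(i * a + c * q * a * b * triangle i) + (j * d' + c * q * d' * e * triangle j)
          + c * q * (i * b) * (j * d' + c * q * d' * e * triangle j)
        - (a * i + c * q * a * b * triangle i + d * q * j) = q * (q * w)"
        by (simp add: d w_def algebra_simps)
      moreover have "\<pi> dvd q * w" using pi_dvd_q by (rule dvd_mult2)
      moreover have "\<pi> dvd (i * b + j * e) - (b * i + j)"
        using e unfolding j by (rule dvd_mult2)
      ultimately have "E ((i * a + c * q * a * b * triangle i)
            + (j * d' + c * q * d' * e * triangle j)
            + c * q * (i * b) * (j * d' + c * q * d' * e * triangle j)) (i * b + j * e)
          = E (a * i + c * q * a * b * triangle i + d * q * j) (b * i + j)"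
        by (rule E_eqI)
      then show ?thesis using that by (simp add: E_pow E_mult)
    qed
    finally show ?thesis .
  qed
  with a show ?thesis using that by blast
qed


text \<open>
  The map prescribed on coordinates respects the congruences and is multiplicative because
  \<open>T (i + k) = T i + T k + i k\<close>: the cross term \<open>i k\<close> is exactly what moving \<open>v ^ (b i)\<close> past
  \<open>u ^ (a k)\<close> produces. The kernel is trivial because the first coordinate of the image of
  \<open>u\<^sup>i v\<^sup>j\<close>, doubled if \<open>p\<close> is odd, is \<open>i\<close> times a unit.
\<close>
lemma ex_automorphism:
  assumes a: "\<not> \<pi> dvd a"
  shows "\<exists>\<phi>\<in>auto G. \<forall>i j. \<phi> (E i j) = E (a * i + c * q * a * b * triangle i) (b * i + j)"
proof -
  define f where "f i j = E (a * i + c * q * a * b * triangle i) (b * i + j)" for i j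
  have f_cong: "f i j = f k l" if eq: "E i j = E k l" for i j k l
  proof -
    from eq obtain s t where s: "i - k = \<pi> * q * s" and t: "j - l = \<pi> * t"
      by (auto simp: E_eq_iff elim!: dvdE)
    then have i: "i = k + \<pi> * q * s" and j: "j = l + \<pi> * t" by auto
    have "\<pi> dvd triangle (\<pi> * q * s)" by (rule pi_dvd_triangle) simp
    then obtain w where w: "triangle (\<pi> * q * s) = \<pi> * w" by blast
    have "(a * i + c * q * a * b * triangle i) - (a * k + c * q * a * b * triangle k)
        = \<pi> * q * (a * s + c * a * b * (w + k * q * s))"
      unfolding i triangle_add w by (simp add: algebra_simps)
    moreover have "(b * i + j) - (b * k + l) = \<pi> * (b * q * s + t)"
      unfolding i j by (simp add: algebra_simps)
    ultimately show ?thesis by (simp add: f_def E_eq_iff)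
  qed
  have f_mult: "f (i + k + c * q * j * k) (j + l) = f i j \<otimes> f k l" for i j k l
  proof -
    have "\<pi> dvd triangle (q * (c * j * k))" by (rule pi_dvd_triangle) simp
    moreover have "triangle (c * q * j * k) = triangle (q * (c * j * k))"
      by (simp add: ac_simps)
    ultimately obtain w where w: "triangle (c * q * j * k) = \<pi> * w" by (auto elim!: dvdE)
    obtain r where r: "q = \<pi> * r" using pi_dvd_q by blast
    have "(a * (i + k + c * q * j * k) + c * q * a * b * triangle (i + k + c * q * j * k))
       - ((a * i + c * q * a * b * triangle i) + (a * k + c * q * a * b * triangle k)
          + c * q * (b * i + j) * (a * k + c * q * a * b * triangle k))
       = q * (c * a * b * (\<pi> * w) + c * a * b * (i + k) * c * q * j * k
           - c * (b * i + j) * c * q * a * b * triangle k)"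
      unfolding triangle_add w by (simp add: algebra_simps)
    moreover have "\<pi> dvd c * a * b * (\<pi> * w) + c * a * b * (i + k) * c * q * j * k
           - c * (b * i + j) * c * q * a * b * triangle k"
      using pi_dvd_q by (intro dvd_diff dvd_add dvd_mult dvd_mult2) auto
    moreover have "\<pi> dvd (b * (i + k + c * q * j * k) + (j + l)) - ((b * i + j) + (b * k + l))"
      using pi_dvd_q by (simp add: algebra_simps)
    ultimately show ?thesis unfolding f_def E_mult by (intro E_eqI)
  qed
  have f_kernel: "E i j = \<one>" if "f i j = \<one>" for i j
  proof -
    from that have 1: "\<pi> * q dvd a * i + c * q * a * b * triangle i" and 2: "\<pi> dvd b * i + j"
      by (auto simp: f_def one_eq E_eq_iff)
    have "\<pi> * q dvd i"
    proof (cases "p = 2")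
      case True
      then obtain r where r: "q = 2 * (2 * r)" using four_dvd_q by (auto elim!: dvdE)
      \<comment> \<open>Half of \<open>q\<close> is still even, which keeps the cofactor of \<open>i\<close> odd.\<close>
      have "a * i + c * q * a * b * triangle i = a * i + c * (2 * r) * a * b * (2 * triangle i)"
        unfolding r by simp
      also have "\<dots> = i * (a + 2 * (c * r * a * b * (i - 1)))"
        unfolding two_triangle by (simp add: algebra_simps)
      finally have "2 * q dvd i * (a + 2 * (c * r * a * b * (i - 1)))" using 1 True by simp
      moreover have "coprime (2 * q) (a + 2 * (c * r * a * b * (i - 1)))"
        using a True by simp
      ultimately show ?thesis using True by (simp add: coprime_dvd_mult_left_iff)
    next
      case False
      have "\<pi> * q dvd 2 * (a * i + c * q * a * b * triangle i)" using 1 by (rule dvd_mult)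
      also have "2 * (a * i + c * q * a * b * triangle i) = 2 * a * i + c * q * a * b * (2 * triangle i)"
        by (simp add: algebra_simps)
      also have "\<dots> = i * (2 * a + q * (c * a * b * (i - 1)))"
        unfolding two_triangle by (simp add: algebra_simps)
      finally have *: "int p ^ m dvd i * (2 * a + q * (c * a * b * (i - 1)))" by (simp add: power_m)
      have "\<not> \<pi> dvd 2" using False prime_p primes_dvd_imp_eq[of p 2] two_is_prime_nat
        by (metis int_dvd_int_iff of_nat_numeral)
      then have "\<not> \<pi> dvd 2 * a" using a prime_dvd_mult_iff[OF prime_pi] by blast
      then have "\<not> \<pi> dvd 2 * a + q * (c * a * b * (i - 1))"
        using pi_dvd_q by (metis dvd_add_left_iff dvd_mult2)
      then have "coprime (int p ^ m) (2 * a + q * (c * a * b * (i - 1)))"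
        using prime_imp_coprime[OF prime_pi] by simp
      then show ?thesis using * by (simp add: coprime_dvd_mult_left_iff power_m)
    qed
    moreover from this have "\<pi> dvd b * i" by (meson dvd_mult dvd_mult_left)
    then have "\<pi> dvd j" using 2 by (simp add: dvd_add_right_iff)
    ultimately show ?thesis by (simp add: one_eq E_eq_iff)
  qed
  \<comment> \<open>The value does not depend on the coordinates chosen, by \<open>f_cong\<close>; members of \<open>auto G\<close> must be
    extensional.\<close>
  define \<phi> where "\<phi> = restrict (\<lambda>g. case_prod f (SOME s. g = case_prod E s)) (carrier G)"
  have \<phi>E: "\<phi> (E i j) = f i j" for i j
  proof -
    obtain k l where kl: "(SOME s. E i j = case_prod E s) = (k, l)" by fastforce
    have "E i j = case_prod E (SOME s. E i j = case_prod E s)"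
      by (rule someI[of _ "(i, j)"]) simp
    then have "f k l = f i j" by (intro f_cong) (simp add: kl)
    with kl have "case_prod f (SOME s. E i j = case_prod E s) = f i j" by simp
    then show ?thesis by (simp add: \<phi>_def)
  qed
  have hom: "\<phi> \<in> hom G G"
  proof (rule homI)
    fix g h assume "g \<in> carrier G" "h \<in> carrier G"
    then obtain i j k l where "g = E i j" "h = E k l" by (auto simp: carrier_eq)
    then show "\<phi> (g \<otimes> h) = \<phi> g \<otimes> \<phi> h" by (simp only: \<phi>E E_mult f_mult)
  next
    fix g assume "g \<in> carrier G"
    then obtain i j where "g = E i j" by (auto simp: carrier_eq)
    then show "\<phi> g \<in> carrier G" by (simp add: \<phi>E f_def)
  qed
  interpret \<phi>: group_hom G G \<phi> by unfold_locales (fact hom)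
  have inj: "inj_on \<phi> (carrier G)"
    using f_kernel by (subst \<phi>.inj_on_one_iff) (auto elim!: E_cases simp: \<phi>E)
  moreover have "\<phi> ` carrier G = carrier G"
    using finite_carrier inj by (intro endo_inj_surj) auto
  ultimately have "\<phi> \<in> Bij (carrier G)"
    by (auto simp: Bij_def bij_betw_def \<phi>_def)
  then have "\<phi> \<in> auto G" using hom by (simp add: auto_def)
  then show ?thesis using \<phi>E unfolding f_def by blast
qed

section \<open>The Reidemeister number of an automorphism\<close>

text \<open>
  With \<open>h = E k l\<close>, comparing coordinates of \<open>E i j \<otimes> h\<close> and \<open>h \<otimes> \<phi> (E i j)\<close> gives \<open>p | b i\<close> and a
  congruence modulo \<open>p q\<close> in which \<open>k\<close> and \<open>l\<close> occur as \<open>q (c a i l - c j k)\<close>. For central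
  \<open>E i j\<close>, that is \<open>p | i\<close> and \<open>p | j\<close>, this term vanishes and the condition no longer involves
  \<open>h\<close>. Otherwise the linear form in \<open>k\<close> and \<open>l\<close> is nonzero modulo \<open>p\<close>: once \<open>q | (a - 1) i\<close> holds,
  exactly one \<open>p\<close>-th of all \<open>h\<close> are solutions.
\<close>
lemma card_twisted_stabilizer:
  assumes a: "\<not> \<pi> dvd a"
    and \<phi>: "\<phi> (E i j) = E (a * i + c * q * a * b * triangle i + d * q * j) (b * i + j)"
  shows "card {h \<in> carrier G. E i j \<otimes> h = h \<otimes> \<phi> (E i j)} =
    (if \<pi> dvd i \<and> \<pi> dvd j
     then if \<pi> * q dvd (a - 1) * i + c * q * a * b * triangle i then p * p ^ m else 0
     else if \<pi> dvd b * i \<and> q dvd (a - 1) * i then p ^ m else 0)"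
proof -
  let ?I = "{0..<\<pi> * q} \<times> {0..<\<pi>}"
  let ?D = "\<lambda>k l. (a - 1) * i + q * (c * a * b * triangle i + d * j - c * j * k + c * a * i * l)"
  have comm: "E i j \<otimes> E k l = E k l \<otimes> \<phi> (E i j) \<longleftrightarrow> \<pi> * q dvd ?D k l \<and> \<pi> dvd b * i" for k l
  proof -
    have "\<pi> * q dvd (i + k + c * q * j * k)
        - (k + (a * i + c * q * a * b * triangle i + d * q * j)
           + c * q * l * (a * i + c * q * a * b * triangle i + d * q * j))
      \<longleftrightarrow> \<pi> * q dvd ?D k l"
    proof -
      have "?D k l = - ((i + k + c * q * j * k)
          - (k + (a * i + c * q * a * b * triangle i + d * q * j)
           + c * q * l * (a * i + c * q * a * b * triangle i + d * q * j)))
        - q * (q * (c * l * (c * a * b * triangle i + d * j)))"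
        by (simp add: algebra_simps)
      moreover have "\<pi> * q dvd q * (q * (c * l * (c * a * b * triangle i + d * j)))"
        using pi_dvd_q by (subst mult.commute[of \<pi>]) (intro mult_dvd_mono, auto)
      ultimately show ?thesis by (metis dvd_diff_left_iff dvd_minus_iff)
    qed
    moreover have "\<pi> dvd (j + l) - (l + (b * i + j)) \<longleftrightarrow> \<pi> dvd b * i" by simp
    ultimately show ?thesis by (simp only: \<phi> E_mult E_eq_iff)
  qed
  have "{h \<in> carrier G. E i j \<otimes> h = h \<otimes> \<phi> (E i j)}
      = case_prod E ` {(k, l). (k, l) \<in> ?I \<and> \<pi> * q dvd ?D k l \<and> \<pi> dvd b * i}" (is "_ = _ ` ?S")
    using bij_betw_imp_surj_on[OF bij_betw_E, symmetric] comm by (fastforce simp: image_iff)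
  moreover have "inj_on (case_prod E) ?S"
    using bij_betw_imp_inj_on[OF bij_betw_E] by (rule inj_on_subset) auto
  ultimately have "card {h \<in> carrier G. E i j \<otimes> h = h \<otimes> \<phi> (E i j)} = card ?S"
    by (simp add: card_image)
  also have "\<dots> = (if \<pi> dvd i \<and> \<pi> dvd j
     then if \<pi> * q dvd (a - 1) * i + c * q * a * b * triangle i then p * p ^ m else 0
     else if \<pi> dvd b * i \<and> q dvd (a - 1) * i then p ^ m else 0)"
  proof (cases "\<pi> dvd i \<and> \<pi> dvd j")
    case True
    then obtain i' j' where "i = \<pi> * i'" "j = \<pi> * j'" by blast
    then have "?D k l = ((a - 1) * i + c * q * a * b * triangle i)
        + \<pi> * q * (d * j' - c * j' * k + c * a * i' * l)" for k l
      by (simp add: algebra_simps)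
    then have "\<pi> * q dvd ?D k l \<longleftrightarrow> \<pi> * q dvd (a - 1) * i + c * q * a * b * triangle i" for k l
      by (metis dvd_add_left_iff dvd_triv_left)
    then have "?S = (if \<pi> * q dvd (a - 1) * i + c * q * a * b * triangle i then ?I else {})"
      using True by auto
    then show ?thesis using True
      by (simp add: card_cartesian_product nat_mult_distrib nat_power_eq power_m)
  next
    case False
    show ?thesis
    proof (cases "\<pi> dvd b * i \<and> q dvd (a - 1) * i")
      case True
      then obtain s where s: "(a - 1) * i = q * s" by blast
      let ?w = "s + c * a * b * triangle i + d * j"
      have "\<pi> * q dvd ?D k l \<longleftrightarrow> \<pi> dvd ?w + - (c * j) * k + (c * a * i) * l" for k l
      proof -
        have "?D k l = (?w + - (c * j) * k + (c * a * i) * l) * q"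
          unfolding s by (simp add: algebra_simps)
        then show ?thesis using q_pos pi_pos by (simp only: dvd_mult_cancel_right) simp
      qed
      then have S: "?S = {(k, l). k \<in> {0..<int (p ^ (m - 1) * p)} \<and> l \<in> {0..<int p} \<and>
          int p dvd ?w + - (c * j) * k + (c * a * i) * l}"
        using True by (auto simp: mult.commute)
      have "\<not> (\<pi> dvd - (c * j) \<and> \<pi> dvd c * a * i)"
        using False a c_unit by (auto simp: prime_dvd_mult_iff[OF prime_pi])
      then have "card ?S = p ^ (m - 1) * p"
        unfolding S by (rule card_affine_congruence_pairs[OF prime_p])
      moreover have "p ^ m = p ^ (m - 1) * p" by (simp add: power_m(2) mult.commute)
      ultimately show ?thesis using True False by (simp only: if_True if_False simp_thms)
    next
      case False': False
      have "q dvd (a - 1) * i" if "\<pi> * q dvd ?D k l" for k l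
        using that by (metis dvd_add_left_iff dvd_mult_right dvd_triv_left)
      then have "?S = {}" using False' by auto
      then have "card ?S = 0" by (simp only: card.empty)
      then show ?thesis using False False' by (simp only: if_False)
    qed
  qed
  finally show ?thesis .
qed

end

text \<open>
  The Reidemeister number as a function of the exponent \<open>b\<close> of \<open>v\<close> in \<open>\<phi> u = u\<^sup>a v\<^sup>b\<close> and of the
  multiplicity \<open>e\<close> of \<open>p\<close> in \<open>a - 1\<close>, cut off at \<open>m - 1\<close>. At the cut-off \<open>e = m - 1\<close>,
  \<open>\<phi> u\<close> and \<open>u v\<^sup>b\<close> agree modulo the commutator subgroup.
\<close>
definition reidemeister_value :: "nat \<Rightarrow> nat \<Rightarrow> nat \<Rightarrow> int \<Rightarrow> nat"
  where "reidemeister_value p m e b =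
    (if e < m - 1 then if p = 2 \<and> e = m - 2 \<and> odd b then 2 ^ m - 2 ^ (m - 2) else p ^ Suc e
     else if int p dvd b then p ^ m + p ^ (m - 1) - p ^ (m - 2)
     else if p = 2 then 2 ^ (m - 1) else 2 * p ^ (m - 1) - p ^ (m - 2))"

context modular_group_coordinates begin

text \<open>
  Summing the stabilizers over \<open>j\<close> first. If \<open>p\<close> does not divide \<open>i\<close>, all \<open>p\<close> choices of \<open>j\<close>
  contribute equally. If it does, \<open>j = 0\<close> is the central element and the other \<open>p - 1\<close> choices are
  noncentral; for these \<open>p | b i\<close> is automatic. A common factor \<open>p ^ m\<close> cancels against the group
  order \<open>p p ^ m\<close>.
\<close>
lemma reidemeister_number_count:
  assumes \<phi>: "\<phi> \<in> auto G" and a: "\<not> \<pi> dvd a"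
    and coord: "\<And>i j. 0 \<le> i \<Longrightarrow> 0 \<le> j \<Longrightarrow>
      \<phi> (E i j) = E (a * i + c * q * a * b * triangle i + d * q * j) (b * i + j)"
  shows "p * reidemeister_number G \<phi> =
      p * card {i \<in> {0..<\<pi> * q}. \<pi> dvd i \<and> \<pi> * q dvd (a - 1) * i + c * q * a * b * triangle i}
    + (p - 1) * card {i \<in> {0..<\<pi> * q}. \<pi> dvd i \<and> q dvd (a - 1) * i}
    + p * card {i \<in> {0..<\<pi> * q}. \<not> \<pi> dvd i \<and> \<pi> dvd b \<and> q dvd (a - 1) * i}"
    (is "_ = p * card {i \<in> _. ?central i} + (p - 1) * card {i \<in> _. ?sub i}
      + p * card {i \<in> _. ?rest i}")
proof -
  define stab where "stab g = {h \<in> carrier G. g \<otimes> h = h \<otimes> \<phi> g}" for g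
  have inner: "(\<Sum>j\<in>{0..<\<pi>}. card (stab (E i j))) =
      p ^ m * (p * of_bool (?central i) + (p - 1) * of_bool (?sub i) + p * of_bool (?rest i))"
    if i: "i \<in> {0..<\<pi> * q}" for i
  proof -
    have card_stab: "card (stab (E i j)) =
      (if \<pi> dvd i \<and> \<pi> dvd j
       then if \<pi> * q dvd (a - 1) * i + c * q * a * b * triangle i then p * p ^ m else 0
       else if \<pi> dvd b * i \<and> q dvd (a - 1) * i then p ^ m else 0)" if "0 \<le> j" for j
      unfolding stab_def
      by (rule card_twisted_stabilizer[OF a, where d = d]) (rule coord, use i that in auto)
    show ?thesis
    proof (cases "\<pi> dvd i")
      case False
      then have "card (stab (E i j)) = p ^ m * of_bool (?rest i)" if "j \<in> {0..<\<pi>}" for j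
        using card_stab[of j] that by (simp add: prime_dvd_mult_iff[OF prime_pi])
      then show ?thesis using False by simp
    next
      case True
      have split: "{0..<\<pi>} = insert 0 {1..<\<pi>}" using pi_pos by auto
      have "card (stab (E i 0)) = p ^ m * (p * of_bool (?central i))"
        using card_stab[of 0] True by simp
      moreover have "card (stab (E i j)) = p ^ m * of_bool (?sub i)" if "j \<in> {1..<\<pi>}" for j
      proof -
        have "\<not> \<pi> dvd j" using that zdvd_not_zless[of j \<pi>] by auto
        then show ?thesis using card_stab[of j] that True by simp
      qed
      moreover have "nat (\<pi> - 1) = p - 1" using pi_pos by linarith
      ultimately show ?thesis unfolding split using True by (simp add: distrib_left)
    qed
  qed
  have count: "(\<Sum>i\<in>{0..<\<pi> * q}. of_bool (P i)) = card {i \<in> {0..<\<pi> * q}. P i}" for P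
  proof -
    have "{i \<in> {0..<\<pi> * q}. P i} = {0..<\<pi> * q} \<inter> Collect P" by blast
    then show ?thesis by (simp add: sum_of_bool_eq)
  qed
  have "reidemeister_number G \<phi> * (p * p ^ m) = card (SIGMA g : carrier G. stab g)"
    using burnside_twisted_conjugacy[OF is_group finite_carrier \<phi>]
    by (simp add: order_eq Sigma_def stab_def) (rule arg_cong[of _ _ card], auto)
  also have "\<dots> = (\<Sum>g\<in>carrier G. card (stab g))"
    using finite_carrier by (intro card_SigmaI) (auto simp: stab_def)
  also have "\<dots> = (\<Sum>s\<in>{0..<\<pi> * q} \<times> {0..<\<pi>}. card (stab (case_prod E s)))"
    by (rule sum.reindex_bij_betw[OF bij_betw_E, symmetric])
  also have "\<dots> = (\<Sum>i\<in>{0..<\<pi> * q}. \<Sum>j\<in>{0..<\<pi>}. card (stab (E i j)))"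
    by (simp add: sum.cartesian_product case_prod_unfold)
  also have "\<dots> = (\<Sum>i\<in>{0..<\<pi> * q}. p ^ m *
      (p * of_bool (?central i) + (p - 1) * of_bool (?sub i) + p * of_bool (?rest i)))"
    using inner by (rule sum.cong[OF refl])
  also have "\<dots> = p ^ m * (p * card {i \<in> {0..<\<pi> * q}. ?central i}
      + (p - 1) * card {i \<in> {0..<\<pi> * q}. ?sub i} + p * card {i \<in> {0..<\<pi> * q}. ?rest i})"
    by (simp only: sum_distrib_left[symmetric] sum.distrib count)
  finally have "p ^ m * (p * reidemeister_number G \<phi>) = \<dots>" by (simp add: ac_simps)
  then show ?thesis using pi_pos by simp
qed

lemma card_multiples_of_pi:
  "card {i \<in> {0..<\<pi> * q}. \<pi> dvd i \<and> P i} = card {i \<in> {0..<q}. P (\<pi> * i)}"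
proof -
  have "{i \<in> {0..<\<pi> * q}. \<pi> dvd i \<and> P i} = (*) \<pi> ` {i \<in> {0..<q}. P (\<pi> * i)}"
    using pi_pos by (auto simp: zero_le_mult_iff image_iff elim!: dvdE)
  moreover have "inj_on ((*) \<pi>) A" for A using pi_pos by (simp add: inj_on_def)
  ultimately show ?thesis by (simp add: card_image)
qed

text \<open>
  In the central count put \<open>i = p i'\<close>. For odd \<open>p\<close> the term with \<open>T i\<close> is divisible by \<open>p q\<close>. For
  \<open>p = 2\<close>, \<open>T (2 i') = i' (2 i' - 1)\<close> is congruent to \<open>- i'\<close> modulo 2, so the term survives and changes
  the coefficient \<open>a - 1\<close> by \<open>c a b (q / 2)\<close>.
\<close>
lemma reidemeister_number_gcd:
  assumes \<phi>: "\<phi> \<in> auto G" and a: "\<not> \<pi> dvd a"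
    and coord: "\<And>i j. 0 \<le> i \<Longrightarrow> 0 \<le> j \<Longrightarrow>
      \<phi> (E i j) = E (a * i + c * q * a * b * triangle i + d * q * j) (b * i + j)"
  shows "\<pi> * int (reidemeister_number G \<phi>) =
      \<pi> * gcd (if p = 2 then a - 1 - c * a * b * (q div 2) else a - 1) q
    + (\<pi> - 1) * gcd (\<pi> * (a - 1)) q
    + (if \<pi> dvd b then \<pi> * (\<pi> * gcd (a - 1) q - gcd (\<pi> * (a - 1)) q) else 0)"
proof -
  let ?A = "if p = 2 then a - 1 - c * a * b * (q div 2) else a - 1"
  have q_nat: "int (p ^ (m - 1)) = q" "p ^ (m - 1) > 0" using prime_p by (simp_all add: prime_gt_0_nat)
  have "\<pi> * q dvd (a - 1) * (\<pi> * i) + c * q * a * b * triangle (\<pi> * i) \<longleftrightarrow> q dvd ?A * i" for i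
  proof (cases "p = 2")
    case True
    then have "2 dvd q" using pi_dvd_q by simp
    then obtain r where r: "q = 2 * r" by blast
    have "2 * triangle (2 * i) = 2 * (i * (2 * i - 1))" by (simp add: two_triangle)
    then have t: "triangle (2 * i) = i * (2 * i - 1)" by simp
    have "(a - 1) * (2 * i) + c * (2 * r) * a * b * triangle (2 * i)
        = 2 * ((a - 1 - c * a * b * r) * i) + 2 * (2 * r) * (c * a * b * i * i)"
      unfolding t by (simp add: algebra_simps)
    then have "(a - 1) * (\<pi> * i) + c * q * a * b * triangle (\<pi> * i)
        = 2 * (?A * i) + \<pi> * q * (c * a * b * i * i)"
      unfolding r using True by simp
    then have "\<pi> * q dvd (a - 1) * (\<pi> * i) + c * q * a * b * triangle (\<pi> * i)
        \<longleftrightarrow> \<pi> * q dvd \<pi> * (?A * i)"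
      using True by (metis dvd_add_left_iff dvd_triv_left of_nat_numeral)
    then show ?thesis using pi_pos by simp
  next
    case False
    then have "\<pi> dvd triangle (\<pi> * i)" by (intro dvd_triangle_odd odd_pi) simp_all
    then have "\<pi> * q dvd c * q * a * b * triangle (\<pi> * i)" by (auto elim!: dvdE)
    then have "\<pi> * q dvd (a - 1) * (\<pi> * i) + c * q * a * b * triangle (\<pi> * i)
        \<longleftrightarrow> \<pi> * q dvd \<pi> * (?A * i)"
      using False by (simp add: dvd_add_left_iff ac_simps)
    then show ?thesis using pi_pos by simp
  qed
  then have central: "int (card {i \<in> {0..<\<pi> * q}. \<pi> dvd i \<and>
      \<pi> * q dvd (a - 1) * i + c * q * a * b * triangle i}) = gcd ?A q"
    using card_linear_congruence[OF q_nat(2), of 1 ?A] q_nat by (simp only: card_multiples_of_pi) simp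
  have sub: "int (card {i \<in> {0..<\<pi> * q}. \<pi> dvd i \<and> q dvd (a - 1) * i}) = gcd (\<pi> * (a - 1)) q"
    using card_linear_congruence[OF q_nat(2), of 1 "\<pi> * (a - 1)"]
    by (simp only: card_multiples_of_pi) (simp add: ac_simps)
  have all: "int (card {i \<in> {0..<\<pi> * q}. q dvd (a - 1) * i}) = \<pi> * gcd (a - 1) q"
    using card_linear_congruence[OF q_nat(2), of p "a - 1"] by simp
  have rest: "int (card {i \<in> {0..<\<pi> * q}. \<not> \<pi> dvd i \<and> \<pi> dvd b \<and> q dvd (a - 1) * i})
    = (if \<pi> dvd b then \<pi> * gcd (a - 1) q - gcd (\<pi> * (a - 1)) q else 0)"
  proof (cases "\<pi> dvd b")
    case True
    have "{i \<in> {0..<\<pi> * q}. \<not> \<pi> dvd i \<and> \<pi> dvd b \<and> q dvd (a - 1) * i}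
      = {i \<in> {0..<\<pi> * q}. q dvd (a - 1) * i} - {i \<in> {0..<\<pi> * q}. \<pi> dvd i \<and> q dvd (a - 1) * i}"
      using True by blast
    moreover have "int (card \<dots>) = int (card {i \<in> {0..<\<pi> * q}. q dvd (a - 1) * i})
        - int (card {i \<in> {0..<\<pi> * q}. \<pi> dvd i \<and> q dvd (a - 1) * i})"
      by (subst card_Diff_subset) (auto simp del: atLeastLessThan_iff intro!: of_nat_diff card_mono)
    ultimately show ?thesis using True by (simp only: all sub if_True)
  qed simp
  have p1: "int (p - 1) = \<pi> - 1" using pi_pos by simp
  note count = reidemeister_number_count[OF \<phi> a, where b = b and d = d]
  have "\<pi> * int (reidemeister_number G \<phi>) = int (p * reidemeister_number G \<phi>)" by simp
  also have "\<dots> = \<pi> * gcd ?A q + (\<pi> - 1) * gcd (\<pi> * (a - 1)) q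
      + \<pi> * (if \<pi> dvd b then \<pi> * gcd (a - 1) q - gcd (\<pi> * (a - 1)) q else 0)"
    by (subst count, erule (1) coord)
      (simp only: of_nat_add of_nat_mult central sub rest p1)
  finally show ?thesis by (simp only: if_distrib[of "(*) \<pi>"] mult_zero_right)
qed

text \<open>
  Dividing the previous formula by \<open>p\<close> leaves, with \<open>F\<close> the number of fixed points in the centre,
  \<open>F + (p - 1) p\<^sup>e\<close> for \<open>e < m - 1\<close>. For \<open>e = m - 1\<close> it leaves
  \<open>F + (p - 1) p ^ (m - 2)\<close>, plus \<open>(p - 1) p ^ (m - 1)\<close> if \<open>p | b\<close>. The number \<open>F\<close> is \<open>p\<^sup>e\<close> except for
  \<open>p = 2\<close> and odd \<open>b\<close>, where \<open>a - 1\<close> is shifted by an odd multiple of \<open>2 ^ (m - 2)\<close>: this leaves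
  \<open>F\<close> unchanged for \<open>e < m - 2\<close>, doubles it for \<open>e = m - 2\<close> (odd plus odd is even), and
  halves it for \<open>e = m - 1\<close>.
\<close>
lemma reidemeister_number_value:
  assumes \<phi>: "\<phi> \<in> auto G" and a: "\<not> \<pi> dvd a"
    and coord: "\<And>i j. 0 \<le> i \<Longrightarrow> 0 \<le> j \<Longrightarrow>
      \<phi> (E i j) = E (a * i + c * q * a * b * triangle i + d * q * j) (b * i + j)"
    and e: "e \<le> m - 1" "\<pi> ^ e dvd a - 1" "e = m - 1 \<or> \<not> \<pi> ^ Suc e dvd a - 1"
  shows "reidemeister_number G \<phi> = reidemeister_value p m e b"
proof -
  let ?R = "int (reidemeister_number G \<phi>)"
  define F where "F = gcd (if p = 2 then a - 1 - c * a * b * (q div 2) else a - 1) q"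
  obtain n where m: "m = n + 2" using m_ge(1) by (metis add.commute le_Suc_ex)
  define r where "r = p ^ n"
  have pw: "p ^ m = p * (p * r)" "p ^ (m - 1) = p * r" "p ^ (m - 2) = r" "q = \<pi> * int r"
    by (simp_all add: m r_def)
  have g: "gcd (a - 1) q = \<pi> ^ e" using gcd_prime_power_eq[OF prime_p e] .
  have R_eq: "\<pi> * ?R = \<pi> * F + (\<pi> - 1) * gcd (\<pi> * (a - 1)) q
    + (if \<pi> dvd b then \<pi> * (\<pi> * \<pi> ^ e - gcd (\<pi> * (a - 1)) q) else 0)"
    using reidemeister_number_gcd[OF \<phi> a coord] unfolding F_def g .
  have ca: "\<not> \<pi> dvd c * a" using a c_unit prime_dvd_mult_iff[OF prime_pi] by blast
  have F_plain: "F = \<pi> ^ e" if "p \<noteq> 2 \<or> even b"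
  proof (cases "p = 2")
    case True
    with that have "even b" by simp
    then obtain b' where b': "b = 2 * b'" by blast
    have q2: "2 * (q div 2) = q" using True pi_dvd_q by simp
    have "a - 1 - c * a * b * (q div 2) = a - 1 - c * a * b' * (2 * (q div 2))"
      by (simp add: b')
    also have "\<dots> = - (c * a * b') * q + (a - 1)" unfolding q2 by simp
    finally have "F = gcd (- (c * a * b') * q + (a - 1)) q"
      unfolding F_def if_P[OF True] by (rule arg_cong)
    also have "\<dots> = gcd q (a - 1)" unfolding gcd.commute[of _ q] by (rule gcd_add_mult)
    also have "\<dots> = \<pi> ^ e" using g by (simp only: gcd.commute[of q "a - 1"])
    finally show ?thesis .
  next
    case False
    then show ?thesis using g by (simp only: F_def if_False)
  qed
  have F_twisted: "F = \<pi> ^ f" if "p = 2" "odd b"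
      "f \<le> m - 1" "\<pi> ^ f dvd (a - 1) - (c * a * b) * \<pi> ^ n"
      "f = m - 1 \<or> \<not> \<pi> ^ Suc f dvd (a - 1) - (c * a * b) * \<pi> ^ n" for f
  proof -
    have "q div 2 = \<pi> ^ n" using that(1) by (simp add: m)
    then show ?thesis using gcd_prime_power_eq[OF prime_p that(3-5)] that(1) by (simp add: F_def)
  qed
  have "reidemeister_number G \<phi> =
    (if e < m - 1 then if p = 2 \<and> e = m - 2 \<and> odd b then 2 ^ m - 2 ^ (m - 2) else p ^ Suc e
     else if \<pi> dvd b then p ^ m + p ^ (m - 1) - p ^ (m - 2)
     else if p = 2 then 2 ^ (m - 1) else 2 * p ^ (m - 1) - p ^ (m - 2))"
  proof (cases "e < m - 1")
    case True
    have "gcd (\<pi> * (a - 1)) q = \<pi> ^ Suc e"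
      using e True pi_pos by (intro gcd_prime_power_eq[OF prime_p]) auto
    then have "\<pi> * ?R = \<pi> * (F + (\<pi> - 1) * \<pi> ^ e)"
      using R_eq by (simp add: algebra_simps)
    then have R: "?R = F + (\<pi> - 1) * \<pi> ^ e" using pi_pos by simp
    show ?thesis
    proof (cases "p = 2 \<and> odd b")
      case False
      then have "?R = \<pi> ^ Suc e" using R F_plain by (auto simp: algebra_simps)
      then show ?thesis using True False by (auto simp flip: of_nat_power of_nat_mult)
    next
      case odd_b: True
      then have cab: "odd (c * a * b)" using ca by simp
      show ?thesis
      proof (cases "e = n")
        case True
        then obtain s where s: "a - 1 = \<pi> ^ n * s" using e by blast
        have "odd s" using e(3) True odd_b unfolding s by (auto simp: m)
        then have "even (s - c * a * b)" using cab by simp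
        then have "\<pi> ^ Suc n dvd (a - 1) - (c * a * b) * \<pi> ^ n"
        proof -
          have "(a - 1) - (c * a * b) * \<pi> ^ n = (s - c * a * b) * \<pi> ^ n"
            unfolding s by (simp add: algebra_simps)
          then show ?thesis using \<open>even (s - c * a * b)\<close> odd_b by (simp add: mult_dvd_mono)
        qed
        then have "F = \<pi> ^ Suc n" using odd_b by (intro F_twisted) (auto simp: m)
        then have "?R = int (3 * 2 ^ n)" using R True odd_b by simp
        then have "reidemeister_number G \<phi> = 3 * 2 ^ n" by (simp only: of_nat_eq_iff)
        then show ?thesis using \<open>e < m - 1\<close> odd_b True by (simp add: m)
      next
        case False
        then have e_n: "Suc e \<le> n" using \<open>e < m - 1\<close> by (simp add: m)
        then have *: "\<pi> ^ Suc e dvd (c * a * b) * \<pi> ^ n" by (intro dvd_mult le_imp_power_dvd)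
        have "\<pi> ^ e dvd (c * a * b) * \<pi> ^ n"
          using e_n by (intro dvd_mult le_imp_power_dvd) simp
        then have "F = \<pi> ^ e"
          using odd_b e True * by (intro F_twisted) (auto simp: dvd_diff_left_iff)
        then have "?R = int (p ^ Suc e)" using R by (simp add: algebra_simps)
        then have "reidemeister_number G \<phi> = p ^ Suc e" by (simp only: of_nat_eq_iff)
        then show ?thesis using True False by (simp add: m)
      qed
    qed
  next
    case False
    then have e': "e = m - 1" using e by simp
    have "q dvd \<pi> * (a - 1)" using e(2) unfolding e' by (rule dvd_mult)
    then have gcd_q: "gcd (\<pi> * (a - 1)) q = q" by (simp add: gcd_proj2_if_dvd)
    have "\<pi> * ?R = \<pi> * (F + (\<pi> - 1) * int r + (if \<pi> dvd b then (\<pi> - 1) * \<pi> * int r else 0))"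
      using R_eq unfolding gcd_q unfolding e' pw by (cases "\<pi> dvd b") (simp_all add: algebra_simps)
    then have R: "?R = F + (\<pi> - 1) * int r + (if \<pi> dvd b then (\<pi> - 1) * \<pi> * int r else 0)"
      using pi_pos by (simp only: mult_cancel_left) simp
    show ?thesis
    proof (cases "p = 2 \<and> odd b")
      case False
      then have "F = \<pi> ^ e" using F_plain by blast
      then have F: "F = \<pi> * int r" unfolding e' pw .
      show ?thesis
      proof (cases "\<pi> dvd b")
        case True
        then have "int (reidemeister_number G \<phi> + r) = int (p * (p * r) + p * r)" using R F True by (simp add: algebra_simps)
        then have "reidemeister_number G \<phi> + r = p * (p * r) + p * r" by (simp only: of_nat_eq_iff)
        then have "reidemeister_number G \<phi> = p ^ m + p ^ (m - 1) - p ^ (m - 2)"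
          unfolding pw by linarith
        then show ?thesis using e' True by (simp only: if_True if_False less_irrefl)
      next
        case nb: False
        then have "int (reidemeister_number G \<phi> + r) = int (2 * (p * r))" using R F nb by (simp add: algebra_simps)
        then have "reidemeister_number G \<phi> + r = 2 * (p * r)" by (simp only: of_nat_eq_iff)
        then have "reidemeister_number G \<phi> = 2 * p ^ (m - 1) - p ^ (m - 2)"
          unfolding pw by linarith
        moreover have "p \<noteq> 2" using nb False by auto
        ultimately show ?thesis using e' nb by (simp only: if_True if_False less_irrefl)
      qed
    next
      case True
      then have cab: "odd (c * a * b)" using ca by simp
      have d: "\<pi> ^ Suc n dvd a - 1" using e(2) e' by (simp add: m)
      have "\<pi> ^ Suc n dvd (c * a * b) * \<pi> ^ n \<longleftrightarrow> \<pi> dvd c * a * b"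
        using pi_pos by (simp only: power_Suc dvd_mult_cancel_right) simp
      then have "\<not> \<pi> ^ Suc n dvd (c * a * b) * \<pi> ^ n" using cab True by simp
      then have "\<not> \<pi> ^ Suc n dvd (a - 1) - (c * a * b) * \<pi> ^ n"
        using dvd_diff[OF d, of "(a - 1) - (c * a * b) * \<pi> ^ n"]
        unfolding diff_diff_eq2[of "a - 1" "a - 1"] add_diff_cancel_left' by blast
      moreover have "\<pi> ^ n dvd a - 1" using d by (rule dvd_trans[rotated]) simp
      then have "\<pi> ^ n dvd (a - 1) - (c * a * b) * \<pi> ^ n" by (rule dvd_diff) simp
      moreover have "n \<le> m - 1" by (simp add: m)
      ultimately have "F = \<pi> ^ n" using True F_twisted[of n] by blast
      then have "?R = int (2 * r)" using R True by (simp add: r_def)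
      then have "reidemeister_number G \<phi> = 2 * r" by (simp only: of_nat_eq_iff)
      also have "\<dots> = p ^ (m - 1)" unfolding pw using True by simp
      finally have "reidemeister_number G \<phi> = p ^ (m - 1)" .
      moreover have "\<not> \<pi> dvd b" using True by simp
      ultimately show ?thesis using e' True by (simp only: if_True if_False less_irrefl simp_thms)
    qed
  qed
  then show ?thesis by (simp only: reidemeister_value_def)
qed


section \<open>The spectrum\<close>

text \<open>
  Every capped multiplicity \<open>e\<close> is realised by \<open>a = 1 + p\<^sup>e\<close>, which is a unit modulo \<open>p\<close> unless
  \<open>p = 2\<close> and \<open>e = 0\<close>; in that case units are odd and \<open>e \<ge> 1\<close> is forced.
\<close>
lemma reidemeister_spectrum_eq:
  "reidemeister_spectrum G = {reidemeister_value p m e b | e b. e \<le> m - 1 \<and> (p = 2 \<longrightarrow> 1 \<le> e)}"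
proof (intro equalityI subsetI)
  fix r assume "r \<in> reidemeister_spectrum G"
  then obtain \<phi> where \<phi>: "\<phi> \<in> auto G" and r: "r = reidemeister_number G \<phi>"
    by (auto simp: reidemeister_spectrum_def)
  obtain a b d where a: "\<not> \<pi> dvd a" and coord: "\<And>i j. 0 \<le> i \<Longrightarrow> 0 \<le> j \<Longrightarrow>
      \<phi> (E i j) = E (a * i + c * q * a * b * triangle i + d * q * j) (b * i + j)"
    using automorphism_coordinates[OF \<phi>] by metis
  obtain e where e: "e \<le> m - 1" "\<pi> ^ e dvd a - 1" "e = m - 1 \<or> \<not> \<pi> ^ Suc e dvd a - 1"
    using obtain_capped_multiplicity[OF prime_p] by metis
  have "1 \<le> e" if "p = 2"
  proof (rule ccontr)
    assume "\<not> 1 \<le> e"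
    then have "e = 0" by simp
    then have "\<not> 2 dvd a - 1" using e(3) m_ge(1) that by auto
    then show False using a that by simp
  qed
  moreover have "r = reidemeister_value p m e b"
    unfolding r using reidemeister_number_value[OF \<phi> a _ e] coord by blast
  ultimately show "r \<in> {reidemeister_value p m e b | e b. e \<le> m - 1 \<and> (p = 2 \<longrightarrow> 1 \<le> e)}"
    using e(1) by blast
next
  fix r assume "r \<in> {reidemeister_value p m e b | e b. e \<le> m - 1 \<and> (p = 2 \<longrightarrow> 1 \<le> e)}"
  then obtain e b where r: "r = reidemeister_value p m e b" and e: "e \<le> m - 1" "p = 2 \<longrightarrow> 1 \<le> e"
    by blast
  define a where "a = 1 + \<pi> ^ e"
  have a: "\<not> \<pi> dvd a"
  proof (cases "e = 0")
    case True
    then show ?thesis using e(2) prime_p primes_dvd_imp_eq[of p 2] two_is_prime_nat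
      unfolding a_def by (metis int_dvd_int_iff not_one_le_zero of_nat_numeral one_add_one power_0)
  next
    case False
    then have "\<pi> dvd \<pi> ^ e" by simp
    then show ?thesis using prime_pi not_prime_unit[of \<pi>] unfolding a_def
      by (metis dvd_add_left_iff)
  qed
  obtain \<phi> where \<phi>: "\<phi> \<in> auto G"
    "\<forall>i j. \<phi> (E i j) = E (a * i + c * q * a * b * triangle i) (b * i + j)"
    using ex_automorphism[OF a] by blast
  have "reidemeister_number G \<phi> = reidemeister_value p m e b"
  proof (rule reidemeister_number_value[OF \<phi>(1) a, where d = 0])
    show "\<phi> (E i j) = E (a * i + c * q * a * b * triangle i + 0 * q * j) (b * i + j)" for i j
      using \<phi>(2) by simp
    have "\<not> \<pi> ^ Suc e dvd \<pi> ^ e"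
      using prime_gt_1_nat[OF prime_p] by (auto dest!: power_dvd_imp_le simp flip: of_nat_power)
    then show "e = m - 1 \<or> \<not> \<pi> ^ Suc e dvd a - 1" by (simp add: a_def)
  qed (use e in \<open>simp_all add: a_def\<close>)
  then show "r \<in> reidemeister_spectrum G"
    using \<phi>(1) unfolding reidemeister_spectrum_def r mem_Collect_eq by metis
qed

lemma reidemeister_spectrum_odd:
  assumes "odd p"
  shows "reidemeister_spectrum G = {p ^ i | i. 1 \<le> i \<and> i \<le> m - 1} \<union>
    {2 * p ^ (m - 1) - p ^ (m - 2), p ^ m + p ^ (m - 1) - p ^ (m - 2)}"
proof (intro equalityI subsetI)
  have p: "p \<noteq> 2" using assms by auto
  fix r assume "r \<in> reidemeister_spectrum G"
  then obtain e b where e: "e \<le> m - 1" and r: "r = reidemeister_value p m e b"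
    unfolding reidemeister_spectrum_eq by blast
  show "r \<in> {p ^ i | i. 1 \<le> i \<and> i \<le> m - 1} \<union>
    {2 * p ^ (m - 1) - p ^ (m - 2), p ^ m + p ^ (m - 1) - p ^ (m - 2)}"
  proof (cases "e < m - 1")
    case True
    then have "r = p ^ Suc e" "1 \<le> Suc e" "Suc e \<le> m - 1"
      using p unfolding r reidemeister_value_def by simp_all
    then show ?thesis by blast
  next
    case False
    then show ?thesis using p unfolding r reidemeister_value_def by simp
  qed
next
  have p: "p \<noteq> 2" using assms by auto
  have mem: "reidemeister_value p m e b \<in> reidemeister_spectrum G" if "e \<le> m - 1" for e b
    using that p unfolding reidemeister_spectrum_eq by blast
  fix r assume "r \<in> {p ^ i | i. 1 \<le> i \<and> i \<le> m - 1} \<union>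
    {2 * p ^ (m - 1) - p ^ (m - 2), p ^ m + p ^ (m - 1) - p ^ (m - 2)}"
  then consider i where "r = p ^ i" "1 \<le> i" "i \<le> m - 1"
    | "r = 2 * p ^ (m - 1) - p ^ (m - 2)" | "r = p ^ m + p ^ (m - 1) - p ^ (m - 2)" by blast
  then show "r \<in> reidemeister_spectrum G"
  proof cases
    case 1
    then have "i - 1 < m - 1" "Suc (i - 1) = i" by simp_all
    then have "reidemeister_value p m (i - 1) 0 = r" using p 1(1) by (simp add: reidemeister_value_def)
    then show ?thesis using mem[of "i - 1" 0] 1 by simp
  next
    case 2
    have "\<not> \<pi> dvd 1" using prime_pi not_prime_unit by blast
    then have "reidemeister_value p m (m - 1) 1 = r"
      unfolding 2 reidemeister_value_def using p by (simp only: if_False less_irrefl)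
    then show ?thesis using mem[of "m - 1" 1] by simp
  next
    case 3
    have "reidemeister_value p m (m - 1) 0 = r"
      unfolding 3 reidemeister_value_def by simp
    then show ?thesis using mem[of "m - 1" 0] by simp
  qed
qed

text \<open>
  The pairs \<open>e < m - 1\<close> with even \<open>b\<close> already yield the powers \<open>2\<^sup>i\<close> for \<open>2 \<le> i \<le> m - 1\<close>. Odd \<open>b\<close>
  contributes one new value, at \<open>e = m - 2\<close>; at \<open>e = m - 1\<close> it only gives \<open>2 ^ (m - 1)\<close> again.
\<close>
lemma reidemeister_spectrum_two:
  assumes p: "p = 2"
  shows "reidemeister_spectrum G = {2 ^ i | i. 2 \<le> i \<and> i \<le> m - 1} \<union>
    {2 ^ m - 2 ^ (m - 2), 2 ^ m + 2 ^ (m - 2)}"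
proof (intro equalityI subsetI)
  obtain n where m: "m = n + 3" using m_ge(2)[OF p] by (metis add.commute le_Suc_ex)
  {
    fix r assume "r \<in> reidemeister_spectrum G"
    then obtain e b where e: "1 \<le> e" "e \<le> m - 1" and r: "r = reidemeister_value p m e b"
      unfolding reidemeister_spectrum_eq using p by blast
    consider "e < m - 1" "\<not> (e = m - 2 \<and> odd b)" | "e = m - 2" "odd b"
      | "e = m - 1" "odd b" | "e = m - 1" "even b" using e by linarith
    then show "r \<in> {2 ^ i | i. 2 \<le> i \<and> i \<le> m - 1} \<union> {2 ^ m - 2 ^ (m - 2), 2 ^ m + 2 ^ (m - 2)}"
    proof cases
      case 1
      then have "r = 2 ^ Suc e" unfolding r reidemeister_value_def using p by auto
      moreover have "2 \<le> Suc e" "Suc e \<le> m - 1" using 1 e by simp_all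
      ultimately show ?thesis by blast
    next
      case 2
      then show ?thesis unfolding r reidemeister_value_def using p m by simp
    next
      case 3
      then have "r = 2 ^ (m - 1)" unfolding r reidemeister_value_def using p by simp
      moreover have "2 \<le> m - 1" using m by simp
      ultimately show ?thesis by blast
    next
      case 4
      then have "r = 2 ^ m + 2 ^ (m - 2)" unfolding r reidemeister_value_def using p by (simp add: m)
      then show ?thesis by blast
    qed
  }
  {
    have mem: "reidemeister_value p m e b \<in> reidemeister_spectrum G" if "1 \<le> e" "e \<le> m - 1" for e b
      using that unfolding reidemeister_spectrum_eq by blast
    fix r assume "r \<in> {2 ^ i | i. 2 \<le> i \<and> i \<le> m - 1} \<union> {2 ^ m - 2 ^ (m - 2), 2 ^ m + (2::nat) ^ (m - 2)}"
    then consider i where "r = 2 ^ i" "2 \<le> i" "i \<le> m - 1"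
      | "r = 2 ^ m - 2 ^ (m - 2)" | "r = 2 ^ m + 2 ^ (m - 2)" by blast
    then show "r \<in> reidemeister_spectrum G"
    proof cases
      case 1
      then have "reidemeister_value p m (i - 1) 0 = 2 ^ Suc (i - 1)"
        using p by (simp only: reidemeister_value_def) auto
      then show ?thesis using mem[of "i - 1" 0] 1 by simp
    next
      case 2
      then have "reidemeister_value p m (m - 2) 1 = r"
        using p by (simp add: reidemeister_value_def m)
      then show ?thesis using mem[of "m - 2" 1] by (simp add: m)
    next
      case 3
      then have "reidemeister_value p m (m - 1) 0 = r"
        using p by (simp add: reidemeister_value_def m)
      then show ?thesis using mem[of "m - 1" 0] by (simp add: m)
    qed
  }
qed

end

section \<open>The semidirect product in coordinates\<close>

lemma cyclic_group_powers:
  fixes N (structure)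
  assumes "group N" "x \<in> carrier N" "generate N {x} = carrier N" "Coset.order N = n" "n > 0"
  shows "x [^] (i::int) = x [^] (j::int) \<longleftrightarrow> int n dvd i - j"
    and "carrier N = range (\<lambda>i::int. x [^] i)"
proof -
  interpret group N by fact
  have "finite (carrier N)" using assms(4,5) by (auto simp: Coset.order_def intro: card_ge_0_finite)
  then have "ord x = n" using generate_pow_card[OF assms(2)] assms(3,4) by (simp add: Coset.order_def)
  then show "x [^] i = x [^] j \<longleftrightarrow> int n dvd i - j"
    using int_pow_eq[OF assms(2)] by (metis dvd_diff_commute)
  show "carrier N = range (\<lambda>i::int. x [^] i)"
    using generate_pow[OF assms(2)] assms(3) by auto
qed

text \<open>
  The relation \<open>v\<^sup>-\<^sup>1 u v = u\<^sup>a\<close> prescribes the inverse of the action of \<open>y\<close>. Since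
  \<open>a \<equiv> 1 + B\<close> with \<open>B = \<beta> q\<close> and \<open>B\<^sup>2 \<equiv> 0\<close> modulo \<open>p ^ m\<close>, the action itself is \<open>\<alpha> y x = x ^ (1 - B)\<close>,
  and its iterates are linear in the exponent: \<open>\<alpha> (y\<^sup>j) x = x ^ (1 - j B)\<close>. This is why the constant of
  the coordinate system is \<open>- \<beta>\<close>.
\<close>
lemma modular_group_coordinates_semidirect_prod:
  fixes N :: "'a monoid" and K :: "'b monoid" and p m \<beta> :: nat and a :: int
  assumes p: "prime p" and m: "m \<ge> 2" "p = 2 \<Longrightarrow> m \<ge> 3"
    and N: "group N" "x \<in> carrier N" "generate N {x} = carrier N" "Coset.order N = p ^ m"
    and K: "group K" "y \<in> carrier K" "generate K {y} = carrier K" "Coset.order K = p"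
    and \<alpha>: "\<alpha> \<in> hom K (AutoGroup N)"
    and conj: "inv\<^bsub>semidirect_prod N K \<alpha>\<^esub> (\<one>\<^bsub>N\<^esub>, y) \<otimes>\<^bsub>semidirect_prod N K \<alpha>\<^esub> (x, \<one>\<^bsub>K\<^esub>)
      \<otimes>\<^bsub>semidirect_prod N K \<alpha>\<^esub> (\<one>\<^bsub>N\<^esub>, y) = (x, \<one>\<^bsub>K\<^esub>) [^]\<^bsub>semidirect_prod N K \<alpha>\<^esub> a"
    and \<beta>: "\<beta> \<in> {1..p - 1}"
    and a: "[a = int (\<beta> * p ^ (m - 1) + 1)] (mod int (p ^ m))"
  shows "modular_group_coordinates (semidirect_prod N K \<alpha>)
    (\<lambda>i j. (x [^]\<^bsub>N\<^esub> i, y [^]\<^bsub>K\<^esub> j)) p m (- int \<beta>)"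
proof -
  define G where "G = semidirect_prod N K \<alpha>"
  interpret N: group N by fact
  interpret K: group K by fact
  interpret G: group G unfolding G_def by (rule group_semidirect_prod[OF N(1) K(1) \<alpha>])
  have G_simps [simp]: "carrier G = carrier N \<times> carrier K"
    "(h, k) \<otimes>\<^bsub>G\<^esub> (h', k') = (h \<otimes>\<^bsub>N\<^esub> \<alpha> k h', k \<otimes>\<^bsub>K\<^esub> k')" for h k h' k'
    by (simp_all add: G_def semidirect_prod_def)
  note act = action_closed[OF N(1) K(1) \<alpha>] action_mult[OF N(1) K(1) \<alpha>]
    action_comp[OF N(1) K(1) \<alpha>] action_one[OF N(1) K(1) \<alpha>]
  note x_eq = cyclic_group_powers(1)[OF N] and y_eq = cyclic_group_powers(1)[OF K]
  have p0: "p > 0" using p by (rule prime_gt_0_nat)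
  define B where "B = int \<beta> * int p ^ (m - 1)"
  have pB: "int (p ^ m) dvd int p * B"
  proof -
    have "p ^ m = p * p ^ (m - 1)" using m(1) by (simp flip: power_Suc)
    then have "int p * B = int (p ^ m) * int \<beta>" by (simp add: B_def)
    then show ?thesis by simp
  qed
  have "int p dvd B" using m(1) by (simp add: B_def)
  then have BB: "int (p ^ m) dvd B * B" using pB by (meson dvd_trans mult_dvd_mono dvd_refl)
  have \<alpha>_hom: "\<alpha> k \<in> hom N N" if "k \<in> carrier K" for k
    using act(1,2) that by (auto intro: homI)
  have \<alpha>_pow: "\<alpha> k (x [^]\<^bsub>N\<^esub> i) = \<alpha> k x [^]\<^bsub>N\<^esub> i" if "k \<in> carrier K" for k and i :: int
    using hom_int_pow[OF \<alpha>_hom[OF that] N(2) N(1) N(1)] .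
  have \<alpha>y: "\<alpha> y x = x [^]\<^bsub>N\<^esub> (1 - B)"
  proof -
    let ?u = "(x, \<one>\<^bsub>K\<^esub>)" and ?v = "(\<one>\<^bsub>N\<^esub>, y)"
    have "(\<lambda>h. (h, \<one>\<^bsub>K\<^esub>)) \<in> hom N G" by (intro homI) (simp_all add: act)
    then have u_pow: "?u [^]\<^bsub>G\<^esub> a = (x [^]\<^bsub>N\<^esub> a, \<one>\<^bsub>K\<^esub>)"
      using hom_int_pow[OF _ N(2) N(1) G.is_group] by metis
    have uv: "?u \<in> carrier G" "?v \<in> carrier G" using N(2) K(2) by simp_all
    have "?v \<otimes>\<^bsub>G\<^esub> (inv\<^bsub>G\<^esub> ?v \<otimes>\<^bsub>G\<^esub> ?u \<otimes>\<^bsub>G\<^esub> ?v) = ?u \<otimes>\<^bsub>G\<^esub> ?v"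
      using uv by (simp only: G.m_assoc[symmetric] G.inv_closed G.m_closed G.r_inv G.l_one)
    then have "?u \<otimes>\<^bsub>G\<^esub> ?v = ?v \<otimes>\<^bsub>G\<^esub> (x [^]\<^bsub>N\<^esub> a, \<one>\<^bsub>K\<^esub>)"
      using conj unfolding G_def[symmetric] u_pow by simp
    then have "x = \<alpha> y x [^]\<^bsub>N\<^esub> a" using N(2) K(2) by (simp add: act \<alpha>_pow)
    moreover obtain r :: int where r: "\<alpha> y x = x [^]\<^bsub>N\<^esub> r"
      using act(1)[OF K(2) N(2)] cyclic_group_powers(2)[OF N] p0 by auto
    ultimately have "x [^]\<^bsub>N\<^esub> (1::int) = x [^]\<^bsub>N\<^esub> (r * a)" using N(2) by (simp add: N.int_pow_pow)
    then have 1: "int (p ^ m) dvd 1 - r * a" using x_eq p0 by simp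
    have 2: "int (p ^ m) dvd a - (B + 1)" using a by (simp add: cong_iff_dvd_diff B_def add.commute)
    have "r - (1 - B) = r * (B * B) - (1 - r * a) * (1 - B) - (a - (B + 1)) * (r * (1 - B))"
      by (simp add: algebra_simps)
    moreover have "int (p ^ m) dvd \<dots>"
      by (rule dvd_diff[OF dvd_diff[OF dvd_mult[OF BB] dvd_mult2[OF 1]] dvd_mult2[OF 2]])
    ultimately have "int (p ^ m) dvd r - (1 - B)" by (simp only:)
    then show ?thesis unfolding r using x_eq p0 by simp
  qed
  have \<alpha>_nat: "\<alpha> (y [^]\<^bsub>K\<^esub> n) (x [^]\<^bsub>N\<^esub> k) = x [^]\<^bsub>N\<^esub> (k * (1 - int n * B))" for n :: nat and k
  proof (induction n arbitrary: k)
    case 0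
    then show ?case using N(2) by (simp add: act)
  next
    case (Suc n)
    have "\<alpha> (y [^]\<^bsub>K\<^esub> Suc n) (x [^]\<^bsub>N\<^esub> k) = \<alpha> (y [^]\<^bsub>K\<^esub> n) (\<alpha> y (x [^]\<^bsub>N\<^esub> k))"
      using N(2) K(2) by (simp add: act)
    also have "\<dots> = x [^]\<^bsub>N\<^esub> ((1 - B) * k * (1 - int n * B))"
      using N(2) K(2) by (simp add: \<alpha>_pow \<alpha>y N.int_pow_pow Suc)
    also have "\<dots> = x [^]\<^bsub>N\<^esub> (k * (1 - int (Suc n) * B))"
    proof -
      have "(1 - B) * k * (1 - int n * B) - k * (1 - int (Suc n) * B) = (k * int n) * (B * B)"
        by (simp add: algebra_simps)
      then have "int (p ^ m) dvd (1 - B) * k * (1 - int n * B) - k * (1 - int (Suc n) * B)"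
        using BB by (simp only: dvd_mult)
      then show ?thesis using x_eq p0 by simp
    qed
    finally show ?case .
  qed
  have \<alpha>_int: "\<alpha> (y [^]\<^bsub>K\<^esub> j) (x [^]\<^bsub>N\<^esub> k) = x [^]\<^bsub>N\<^esub> (k * (1 - j * B))" for j k :: int
  proof -
    define n where "n = nat (j mod int p)"
    have n: "int p dvd int n - j" using p0 by (simp add: n_def mod_eq_dvd_iff[symmetric])
    then have "y [^]\<^bsub>K\<^esub> j = y [^]\<^bsub>K\<^esub> int n" using y_eq p0 by (simp add: dvd_diff_commute)
    then have "\<alpha> (y [^]\<^bsub>K\<^esub> j) (x [^]\<^bsub>N\<^esub> k) = x [^]\<^bsub>N\<^esub> (k * (1 - int n * B))"
      by (simp only: int_pow_int \<alpha>_nat)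
    also have "\<dots> = x [^]\<^bsub>N\<^esub> (k * (1 - j * B))"
    proof -
      obtain t where "int n - j = int p * t" using n by blast
      then have "int n = j + int p * t" by simp
      then have "k * (1 - int n * B) - k * (1 - j * B) = (int p * B) * (- k * t)"
        by (simp add: algebra_simps)
      then have "int (p ^ m) dvd k * (1 - int n * B) - k * (1 - j * B)"
        using pB by (simp only: dvd_mult2)
      then show ?thesis using x_eq p0 by simp
    qed
    finally show ?thesis .
  qed
  show ?thesis unfolding G_def[symmetric]
  proof (intro modular_group_coordinates.intro modular_group_coordinates_axioms.intro)
    show "group G" by (rule G.is_group)
    show "\<not> int p dvd - int \<beta>"
      using \<beta> p0 by (auto dest: dvd_imp_le)
    show "carrier G = range (\<lambda>(i, j). (x [^]\<^bsub>N\<^esub> (i::int), y [^]\<^bsub>K\<^esub> (j::int)))"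
      using cyclic_group_powers(2)[OF N] cyclic_group_powers(2)[OF K] p0 by auto
    fix i j k l :: int
    show "(x [^]\<^bsub>N\<^esub> i, y [^]\<^bsub>K\<^esub> j) = (x [^]\<^bsub>N\<^esub> k, y [^]\<^bsub>K\<^esub> l) \<longleftrightarrow>
        int p ^ m dvd i - k \<and> int p dvd j - l"
      using x_eq y_eq p0 by simp
    have "x [^]\<^bsub>N\<^esub> i \<otimes>\<^bsub>N\<^esub> \<alpha> (y [^]\<^bsub>K\<^esub> j) (x [^]\<^bsub>N\<^esub> k) = x [^]\<^bsub>N\<^esub> (i + k * (1 - j * B))"
      using N(2) by (simp only: \<alpha>_int N.int_pow_mult)
    also have "i + k * (1 - j * B) = i + k + - int \<beta> * int p ^ (m - 1) * j * k"
      by (simp add: B_def algebra_simps)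
    finally show "(x [^]\<^bsub>N\<^esub> i, y [^]\<^bsub>K\<^esub> j) \<otimes>\<^bsub>G\<^esub> (x [^]\<^bsub>N\<^esub> k, y [^]\<^bsub>K\<^esub> l) =
        (x [^]\<^bsub>N\<^esub> (i + k + - int \<beta> * int p ^ (m - 1) * j * k), y [^]\<^bsub>K\<^esub> (j + l))"
      using K(2) by (simp add: K.int_pow_mult)
  qed (use p m in auto)
qed

theorem theorem4p3p4:
  fixes p m \<beta> :: nat and a :: int
    and N :: "'a monoid" and K :: "'b monoid" and \<alpha> :: "'b \<Rightarrow> 'a \<Rightarrow> 'a"
    and x :: 'a and y :: 'b
    and G :: "('a \<times> 'b) monoid" and u v :: "'a \<times> 'b"
  assumes "Factorial_Ring.prime p"
    and "odd p \<Longrightarrow> m \<ge> 2" and "p = 2 \<Longrightarrow> m \<ge> 3"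
    and "group N" and "x \<in> carrier N" and "generate N {x} = carrier N" and "Coset.order N = p ^ m"
    and "group K" and "y \<in> carrier K" and "generate K {y} = carrier K" and "Coset.order K = p"
    and "\<alpha> \<in> hom K (AutoGroup N)"
  defines "G \<equiv> semidirect_prod N K \<alpha>"
    and "u \<equiv> (x, \<one>\<^bsub>K\<^esub>)" and "v \<equiv> (\<one>\<^bsub>N\<^esub>, y)"
  assumes "inv\<^bsub>G\<^esub> v \<otimes>\<^bsub>G\<^esub> u \<otimes>\<^bsub>G\<^esub> v = u [^]\<^bsub>G\<^esub> a"
    and "\<beta> \<in> {1..p - 1}"
    and "[a = int (\<beta> * p ^ (m - 1) + 1)] (mod int (p ^ m))"
  shows "(odd p \<longrightarrow> reidemeister_spectrum G =
            {p ^ i | i. 1 \<le> i \<and> i \<le> m - 1} \<union>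
            {2 * p ^ (m - 1) - p ^ (m - 2), p ^ m + p ^ (m - 1) - p ^ (m - 2)}) \<and>
         (p = 2 \<longrightarrow> reidemeister_spectrum G =
            {2 ^ i | i. 2 \<le> i \<and> i \<le> m - 1} \<union>
            {2 ^ m - 2 ^ (m - 2), 2 ^ m + 2 ^ (m - 2)})"
proof -
  have "m \<ge> 2"
    using assms(2,3) prime_odd_nat[OF assms(1)] prime_ge_2_nat[OF assms(1)] by (cases "p = 2") auto
  interpret modular_group_coordinates G "\<lambda>i j. (x [^]\<^bsub>N\<^esub> i, y [^]\<^bsub>K\<^esub> j)" p m "- int \<beta>"
    unfolding G_def
    by (rule modular_group_coordinates_semidirect_prod)
      (use assms \<open>m \<ge> 2\<close> in \<open>simp_all only: G_def u_def v_def\<close>)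
  show ?thesis using reidemeister_spectrum_odd reidemeister_spectrum_two by blast
qed

end
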